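(* Let $\lambda$ be a Galois conjugate of a bi-Perron number. Then the following are equivalent. (a) All Galois conjugates of $\lambda$ are contained in $\mathbf{S}^1\cup\mathbf{R}$. (b) The number $\lambda^2$ is an eigenvalue of a Coxeter transformation associated with a tree.
   Context: A bi-Perron number $\mu$ is a real algebraic unit $>1$ all of whose Galois conjugates (over $\mathbf{Q}$) have modulus in the open interval $(\mu^{-1},\mu)$, except for $\mu$ itself and possibly one of $\pm\mu^{-1}$. Here $\mathbf{S}^1\subset\mathbf{C}$ denotes the complex unit circle. Coxeter transformation associated with a tree: let $\Gamma$ be a finite tree, viewed as a Coxeter diagram in which every edge has Coxeter weight $3$. A tree is bipartite; let $V=V_0\sqcup V_1$ be the bipartition of its vertices. On the real vector space with basis $(e_v)_{v\in V}$ consider the symmetric bilinear form $B$ with $B(e_v,e_v)=1$, $B(e_v,e_w)=-\tfrac12$ if $v\neq w$ are adjacent, and $B(e_v,e_w)=0$ if $v\neq w$ are not adjacent. Let $\sigma_v(x)=x-2B(x,e_v)e_v$. The Coxeter transformation associated with $\Gamma$ is the linear map $\left(\prod_{v\in V_0}\sigma_v\right)\left(\prod_{v\in V_1}\sigma_v\right)$ (the reflections within each of the two products commute); it is well defined up to conjugation. Eigenvalues are taken over $\mathbf{C}$. *)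

theory Defs
  imports
    "Graph_Theory.Digraph_Component"
    "Jordan_Normal_Form.Char_Poly"
begin

section \<open>Bi-Perron numbers\<close>

text \<open>
  The polynomial \<open>p\<close> below is the minimal polynomial of \<open>z\<close> over the rationals. A number is among
  its own conjugates, and a transcendental number has none.
\<close>

definition galois_conjugates :: "complex \<Rightarrow> complex set" where
  "galois_conjugates z =
     {w. \<exists>p :: rat poly. irreducible p \<and> lead_coeff p = 1 \<and>
           poly (map_poly of_rat p) z = 0 \<and> poly (map_poly of_rat p) w = 0}"

definition algebraic_unit :: "'a :: field \<Rightarrow> bool" where
  "algebraic_unit x \<longleftrightarrow> x \<noteq> 0 \<and> algebraic_int x \<and> algebraic_int (inverse x)"

text \<open>The sign \<open>s\<close> selects which one of \<open>1 / \<mu>\<close> and \<open>- 1 / \<mu>\<close> is allowed as an exception.\<close>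

definition bi_Perron :: "real \<Rightarrow> bool" where
  "bi_Perron \<mu> \<longleftrightarrow> algebraic_unit \<mu> \<and> \<mu> > 1 \<and>
     (\<exists>s \<in> {1, -1}. \<forall>z \<in> galois_conjugates (complex_of_real \<mu>).
        z \<noteq> complex_of_real \<mu> \<and> z \<noteq> complex_of_real (s / \<mu>) \<longrightarrow>
        cmod z \<in> {inverse \<mu> <..< \<mu>})"

section \<open>Finite trees\<close>

text \<open>
  A finite simple graph is a \<^locale>\<open>pair_graph\<close>: a finite loop-free digraph with symmetric arc
  relation. The library's predicate for trees does not apply here: in a symmetric digraph, going
  forth and back along an edge is a directed cycle of length 2. The cycles of the undirected graph
  are those of length at least 3.
\<close>

definition finite_tree :: "'v pair_pre_digraph \<Rightarrow> bool" where
  "finite_tree G \<longleftrightarrow> pair_graph G \<and> Digraph_Component.connected (with_proj G) \<and>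
     \<not> (\<exists>p. pre_digraph.cycle (with_proj G) p \<and> 3 \<le> length p)"

definition bipartition :: "'v pair_pre_digraph \<Rightarrow> 'v set \<Rightarrow> 'v set \<Rightarrow> bool" where
  "bipartition G V\<^sub>0 V\<^sub>1 \<longleftrightarrow> V\<^sub>0 \<union> V\<^sub>1 = pverts G \<and> V\<^sub>0 \<inter> V\<^sub>1 = {} \<and>
     (\<forall>(u, v) \<in> parcs G. (u \<in> V\<^sub>0 \<and> v \<in> V\<^sub>1) \<or> (u \<in> V\<^sub>1 \<and> v \<in> V\<^sub>0))"

section \<open>Coxeter transformations\<close>

text \<open>
  Graphs in this section have vertex set \<open>{..<n}\<close>, so that the basis vector of the vertex \<open>v\<close> is
  \<open>unit_vec n v\<close>. Up to isomorphism this covers all finite graphs, and isomorphic graphs have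
  conjugate Coxeter transformations.
\<close>

definition coxeter_gram :: "nat pair_pre_digraph \<Rightarrow> real mat" where
  "coxeter_gram G = mat (card (pverts G)) (card (pverts G))
     (\<lambda>(v, w). if v = w then 1 else if (v, w) \<in> parcs G then - 1 / 2 else 0)"

definition coxeter_form :: "nat pair_pre_digraph \<Rightarrow> real vec \<Rightarrow> real vec \<Rightarrow> real" where
  "coxeter_form G x y = x \<bullet> (coxeter_gram G *\<^sub>v y)"

definition coxeter_reflection :: "nat pair_pre_digraph \<Rightarrow> nat \<Rightarrow> real vec \<Rightarrow> real vec" where
  "coxeter_reflection G v x =
     (let e\<^sub>v = unit_vec (card (pverts G)) v in x - (2 * coxeter_form G x e\<^sub>v) \<cdot>\<^sub>v e\<^sub>v)"

text \<open>
  The order of the factors within \<open>V\<^sub>0\<close>, and within \<open>V\<^sub>1\<close>, is immaterial, as reflections in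
  distinct non-adjacent vertices commute. Note that \<open>foldr f [u, v] = f u \<circ> f v\<close>.
\<close>

definition coxeter_transformation ::
    "nat pair_pre_digraph \<Rightarrow> nat set \<Rightarrow> nat set \<Rightarrow> real vec \<Rightarrow> real vec" where
  "coxeter_transformation G V\<^sub>0 V\<^sub>1 =
     foldr (coxeter_reflection G) (sorted_list_of_set V\<^sub>0) \<circ>
     foldr (coxeter_reflection G) (sorted_list_of_set V\<^sub>1)"

text \<open>The matrix of a linear map with respect to the standard basis.\<close>

definition matrix_of :: "nat \<Rightarrow> (real vec \<Rightarrow> real vec) \<Rightarrow> real mat" where
  "matrix_of n T = mat_of_cols n (map (\<lambda>j. T (unit_vec n j)) [0..<n])"

definition coxeter_tree_eigenvalue :: "complex \<Rightarrow> bool" where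
  "coxeter_tree_eigenvalue z \<longleftrightarrow>
     (\<exists>n G V\<^sub>0 V\<^sub>1. finite_tree G \<and> pverts G = {..<n} \<and> bipartition G V\<^sub>0 V\<^sub>1 \<and>
        eigenvalue (map_mat complex_of_real
          (matrix_of n (coxeter_transformation G V\<^sub>0 V\<^sub>1))) z)"

end

theory Submission
  imports
    Defs
    "HOL-Computational_Algebra.Field_as_Ring"
    "HOL-Computational_Algebra.Fundamental_Theorem_Algebra"
    "HOL-Real_Asymp.Real_Asymp"
    "Subresultants.Subresultant_Gcd"
begin

text \<open>
  Put \<open>\<alpha> = \<lambda> + 1 / \<lambda>\<close>. On a bipartite graph with adjacency matrix \<open>A\<close>, multiplying an eigenvector
  of \<open>A\<close> for \<open>\<alpha>\<close> by \<open>\<lambda>\<close> on one side of the bipartition gives an eigenvector of the Coxeter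
  transformation for \<open>\<lambda>\<^sup>2\<close>; the two eigenvector equations are spelled out in
  \<open>coxeter_eigenvalue_iff\<close>.

  From (b) to (a): pairing these two equations with the eigenvector itself shows that every
  eigenvalue of a Coxeter transformation of a bipartite graph lies on the unit circle or on the
  positive real axis (\<open>coxeter_eigenvalue_location\<close>). The transformation has an integral matrix, so
  the square of each conjugate of \<open>\<lambda>\<close> is again an eigenvalue, and (a) follows by taking square
  roots.

  From (a) to (b): as \<open>\<lambda>\<close> is a unit, \<open>\<alpha>\<close> is an algebraic integer, and (a) makes all its conjugates
  real. It remains to see that every totally real algebraic integer is an eigenvalue of a tree, a
  theorem of Salez; the proof below is organised around the set \<open>B\<close> of branch sums. Let \<open>x\<close> be a
  vector on a rooted tree that satisfies \<open>A x = \<alpha> x\<close> away from the root and has the value 1 at the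
  root. The sum of \<open>x\<close> over the neighbours of the root is a branch sum, and \<open>\<alpha>\<close> is an eigenvalue of
  a tree as soon as \<open>\<alpha> \<in> B\<close>. A single vertex gives \<open>0 \<in> B\<close>, and joining two roots by an edge gives
  \<open>s + 1 / (\<alpha> - t) \<in> B\<close> for \<open>s, t \<in> B\<close> with \<open>t \<noteq> \<alpha>\<close> (\<open>branch_sum_realised\<close>). These two rules define
  an additive monoid (\<open>branch_sums_add\<close>), which is taken as \<open>B\<close>. Suppose \<open>\<alpha> \<notin> B\<close>, so that \<open>B\<close> is
  closed under \<open>t \<mapsto> 1 / (\<alpha> - t)\<close>. Put \<open>\<theta> = \<alpha>\<^sup>2\<close>; all elements of \<open>B\<close> lie in \<open>\<alpha> \<rat>(\<theta>)\<close>. A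
  contradiction arises in two steps, one at the real places and one at the primes.

  Archimedean part. Embed \<open>\<rat>(\<theta>)\<close> into \<open>\<real>\<^sup>d\<close> by its \<open>d\<close> embeddings, all of which are real. Small
  trees give branch sums whose positive multiples come arbitrarily close to \<open>(-1, \<dots>, -1)\<close> and to
  each standard basis vector; here it matters that the conjugates of \<open>\<theta>\<close> are distinct and positive.
  Vectors so close to these \<open>d + 1\<close> ones have a linear relation with rational coefficients, and all
  its coefficients have the same sign. Hence \<open>B\<close> is a group that contains a positive multiple of
  every element of \<open>\<alpha> \<rat>(\<theta>)\<close> (\<open>negative_multiple_in_branch_polys\<close>), and as \<open>\<theta>\<close> is integral, it
  contains \<open>m \<alpha> \<int>[\<theta>]\<close> for some \<open>m > 0\<close> (\<open>integral_multiples\<close>).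

  Arithmetic part. The Moebius map \<open>u \<mapsto> \<alpha> - 1 / u\<close> preserves \<open>\<alpha> - B\<close>; its matrix has determinant 1
  and entries in \<open>\<int>[\<alpha>]\<close>, so it has finite order modulo \<open>m\<close>. The orbit of \<open>\<infinity>\<close> therefore returns
  modulo \<open>m\<close> to the preimage \<open>0\<close> of \<open>\<infinity>\<close>: this gives \<open>u\<close> with \<open>\<alpha> - u \<in> B\<close> of the form
  \<open>\<alpha> m a / (m b - 1)\<close> with \<open>a, b \<in> \<int>[\<theta>]\<close> (\<open>paths_periodic\<close>). A norm \<open>N\<close> of \<open>1 - m b\<close> is an
  integer congruent to 1 modulo \<open>m\<close>, and multiplying by it puts \<open>N \<alpha>\<close> into \<open>B\<close>. Since \<open>m \<alpha> \<in> B\<close> as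
  well, \<open>\<alpha> \<in> B\<close> (\<open>not_algebraic_int\<close>).
\<close>

section \<open>Polynomials at algebraic numbers\<close>

abbreviation eval_rat :: "rat poly \<Rightarrow> 'a :: field_char_0 \<Rightarrow> 'a" where
  "eval_rat p z \<equiv> poly (map_poly of_rat p) z"

abbreviation eval_int :: "int poly \<Rightarrow> 'a :: field_char_0 \<Rightarrow> 'a" where
  "eval_int p z \<equiv> poly (map_poly of_int p) z"

interpretation of_rat_poly_hom: map_poly_inj_idom_hom of_rat ..

lemma comm_ring_hom_eval_rat: "comm_ring_hom (\<lambda>p. eval_rat p z)"
  by unfold_locales (auto simp: of_rat_poly_hom.hom_add of_rat_poly_hom.hom_mult)

lemma irreducible_dvd_if_common_root:
  assumes "irreducible p" "eval_rat p z = 0" "eval_rat q z = 0"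
  shows "p dvd q"
proof (rule ccontr)
  assume "\<not> p dvd q"
  then have "coprime p q"
    using assms(1) by (meson comm_semiring_1_class.irreducibleD' coprime_def dvd_trans)
  then obtain u v where "u * p + v * q = 1"
    by (metis bezout_coefficients_fst_snd coprime_imp_gcd_eq_1)
  then have "eval_rat (u * p + v * q) z = 1" by simp
  then show False
    using assms(2,3) by (simp add: of_rat_poly_hom.hom_add of_rat_poly_hom.hom_mult)
qed

lemma eval_rat_eq_0_if_dvd:
  assumes "p dvd q" "eval_rat p z = 0"
  shows "eval_rat q z = 0"
  using assms by (auto elim!: dvdE simp: of_rat_poly_hom.hom_mult)

text \<open>
  A nonzero polynomial of least degree with the given root cannot be factored.
\<close>

lemma exists_irreducible_with_root:
  assumes "q \<noteq> 0" "eval_rat q z = 0"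
  shows "\<exists>f. irreducible f \<and> eval_rat f z = 0"
proof -
  define P where "P f \<longleftrightarrow> f \<noteq> 0 \<and> eval_rat f z = 0" for f
  obtain f where f: "P f" "\<And>g. P g \<Longrightarrow> degree f \<le> degree g"
    using arg_min_nat_lemma[of P q degree] assms unfolding P_def by blast
  have "irreducible f"
  proof (rule irreducibleI)
    show "f \<noteq> 0" using f(1) by (simp add: P_def)
    show "\<not> f dvd 1"
      using f(1) eval_rat_eq_0_if_dvd[of f 1 z] by (auto simp: P_def)
    fix a b assume ab: "f = a * b"
    with f(1) have nz: "a \<noteq> 0" "b \<noteq> 0" by (auto simp: P_def)
    have "eval_rat a z * eval_rat b z = 0"
      using f(1) ab by (simp add: P_def of_rat_poly_hom.hom_mult)
    then have "P a \<or> P b" using nz by (auto simp: P_def)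
    then have "degree a + degree b \<le> degree a \<or> degree a + degree b \<le> degree b"
      using f(2) nz by (metis ab degree_mult_eq)
    then have "degree b = 0 \<or> degree a = 0" by auto
    then show "a dvd 1 \<or> b dvd 1" using nz by (auto simp: is_unit_iff_degree)
  qed
  with f(1) show ?thesis by (auto simp: P_def)
qed

lemma irreducible_degree_pos:
  fixes f :: "rat poly"
  assumes "irreducible f"
  shows "degree f > 0"
  using assms is_unit_iff_degree[of f] by (auto simp: irreducible_def)

lemma card_roots_irreducible:
  assumes "irreducible f"
  shows "card {z :: complex. eval_rat f z = 0} = degree f"
proof -
  let ?g = "map_poly of_rat f :: complex poly"
  have "f \<noteq> 0" using assms by auto
  have "rsquarefree ?g"
    unfolding rsquarefree_roots
  proof (intro allI notI)
    fix a assume a: "poly ?g a = 0 \<and> poly (pderiv ?g) a = 0"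
    have "pderiv ?g = map_poly of_rat (pderiv f)"
      by (simp add: of_rat_hom.map_poly_pderiv)
    then have "f dvd pderiv f"
      using a irreducible_dvd_if_common_root[OF assms] by metis
    moreover have "pderiv f \<noteq> 0"
      using irreducible_degree_pos[OF assms] by (simp add: pderiv_eq_0_iff)
    ultimately have "degree f \<le> degree (pderiv f)" by (rule dvd_imp_degree_le)
    then show False using irreducible_degree_pos[OF assms] by (simp add: degree_pderiv)
  qed
  from complex_poly_decompose_rsquarefree[OF this]
  have "degree ?g = degree (Polynomial.smult (lead_coeff ?g) (\<Prod>z|poly ?g z = 0. [:-z, 1:]))" by simp
  also have "\<dots> = card {z. poly ?g z = 0}"
    using \<open>f \<noteq> 0\<close> by (subst degree_smult_eq) (auto simp: degree_prod_eq_sum_degree)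
  finally show ?thesis by simp
qed

text \<open>
  Division by the monic \<open>P\<close> shows that the powers below the degree of \<open>P\<close> span \<open>\<int>[l]\<close>. This finite
  generation is the only way in which integrality is used.
\<close>

lemma eval_int_reduce:
  fixes l :: "'a :: field_char_0"
  assumes "lead_coeff P = 1" "eval_int P l = 0"
  shows "\<exists>r. eval_int q l = (\<Sum>i<degree P. of_int (r i) * l ^ i)"
proof -
  have "P \<noteq> 0" using assms(1) by auto
  have "degree P \<noteq> 0"
  proof
    assume "degree P = 0"
    then have "P = 1" using assms(1) by (metis degree_0_id lead_coeff_1 of_int_hom.hom_one pCons_one)
    with assms(2) show False by simp
  qed
  obtain s r where sr: "pseudo_divmod q P = (s, r)" by fastforce
  from pseudo_divmod[OF \<open>P \<noteq> 0\<close> sr] assms(1) \<open>degree P \<noteq> 0\<close>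
  have *: "q = P * s + r" "degree r < degree P" by auto
  have "eval_int q l = eval_int r l"
    using assms(2) by (simp add: *(1) of_int_poly_hom.hom_add of_int_poly_hom.hom_mult)
  also have "\<dots> = (\<Sum>i\<le>degree r. of_int (coeff r i) * l ^ i)"
    by (simp add: poly_altdef)
  also have "\<dots> = (\<Sum>i<degree P. of_int (coeff r i) * l ^ i)"
    using *(2) by (intro sum.mono_neutral_left) (auto simp: coeff_eq_0)
  finally show ?thesis by (rule exI[of _ "coeff r"])
qed

text \<open>
  Multiplication by an element \<open>b\<close> of the finitely generated \<open>\<int>[l]\<close> is given by an integral matrix
  with eigenvalue \<open>b\<close>, whose characteristic polynomial is monic and integral.
\<close>

lemma algebraic_int_eval_int:
  fixes l :: "'a :: field_char_0"
  assumes "algebraic_int l"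
  shows "algebraic_int (eval_int q l)"
proof -
  obtain P where P: "eval_int P l = 0" "lead_coeff P = 1"
    using assms by (auto simp: algebraic_int_altdef_ipoly)
  let ?n = "degree P" and ?b = "eval_int q l"
  have "\<exists>r. \<forall>i. ?b * l ^ i = (\<Sum>j<?n. of_int (r i j) * l ^ j)"
  proof (intro choice allI)
    fix i
    show "\<exists>r. ?b * l ^ i = (\<Sum>j<?n. of_int (r j) * l ^ j)"
      using eval_int_reduce[OF P(2,1), of "q * monom 1 i"]
      by (simp add: of_int_poly_hom.hom_mult map_poly_monom poly_monom)
  qed
  then obtain r where r: "\<And>i. ?b * l ^ i = (\<Sum>j<?n. of_int (r i j) * l ^ j)" by blast
  define C where "C = mat ?n ?n (\<lambda>(i, j). r i j)"
  have C: "C \<in> carrier_mat ?n ?n" by (simp add: C_def)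
  define w where "w = vec ?n (\<lambda>i. l ^ i)"
  have "?n \<noteq> 0"
  proof
    assume "?n = 0"
    then have "P = 1" using P(2) by (metis degree_0_id lead_coeff_1 of_int_hom.hom_one pCons_one)
    with P(1) show False by simp
  qed
  have "eigenvector (map_mat of_int C) w ?b"
    unfolding eigenvector_def
  proof (intro conjI)
    show "w \<in> carrier_vec (dim_row (map_mat of_int C))" by (simp add: w_def C_def)
    show "w \<noteq> 0\<^sub>v (dim_row (map_mat of_int C))"
    proof
      assume "w = 0\<^sub>v (dim_row (map_mat of_int C))"
      then have "w $ 0 = 0" using \<open>?n \<noteq> 0\<close> by (simp add: C_def)
      then show False using \<open>?n \<noteq> 0\<close> by (simp add: w_def)
    qed
    show "map_mat of_int C *\<^sub>v w = ?b \<cdot>\<^sub>v w"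
      by (rule eq_vecI) (auto simp: C_def w_def scalar_prod_def r atLeast0LessThan)
  qed
  then have "poly (char_poly (map_mat of_int C)) ?b = 0"
    using eigenvalue_root_char_poly[of "map_mat of_int C" ?n ?b] C by (auto simp: eigenvalue_def)
  then have "eval_int (char_poly C) ?b = 0"
    by (simp add: of_int_hom.char_poly_hom[OF C])
  then show ?thesis
    using degree_monic_char_poly[OF C] by (auto simp: algebraic_int_altdef_ipoly)
qed

text \<open>
  For monic \<open>X\<close> of degree \<open>n\<close> with \<open>X(b) = 0\<close>, the integer \<open>N = m\<^sup>n X(1/m)\<close> is congruent to 1 modulo \<open>m\<close>
  and divisible by \<open>1 - m b\<close>; it plays the role of the norm of \<open>1 - m b\<close>. Stating this for arbitrary \<open>X\<close>
  allows an induction on the coefficients.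
\<close>

lemma int_multiple_of_one_minus:
  fixes b :: "'a :: field_char_0" and m :: int
  assumes "degree X \<le> n"
  shows "\<exists>E N. of_int N - of_int m ^ n * eval_int X b = (1 - of_int m * b) * eval_int E b \<and>
               m dvd N - coeff X n"
  using assms
proof (induction n arbitrary: X)
  case 0
  then obtain c where "X = [:c:]" by (auto elim: degree_eq_zeroE)
  then show ?case by (intro exI[of _ "0 :: int poly"] exI[of _ c]) (auto simp: of_int_hom.map_poly_pCons_hom)
next
  case (Suc n)
  obtain a Y where X: "X = pCons a Y" by (cases X)
  with Suc.prems have "degree Y \<le> n" by (auto split: if_splits)
  from Suc.IH[OF this] obtain E N where
    EN: "of_int N - of_int m ^ n * eval_int Y b = (1 - of_int m * b) * eval_int E b"
        "m dvd N - coeff Y n" by blast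
  let ?E = "Polynomial.smult m (monom 1 1 * E) + [:N:]" and ?N = "a * m ^ Suc n + N"
  have "of_int ?N - of_int m ^ Suc n * eval_int X b
      = (of_int N - of_int m ^ n * eval_int Y b) * (of_int m * b) + of_int N * (1 - of_int m * b)"
    by (simp add: X of_int_hom.map_poly_pCons_hom algebra_simps)
  also have "\<dots> = (1 - of_int m * b) * eval_int ?E b"
    unfolding EN(1)
    by (simp add: of_int_poly_hom.hom_add of_int_poly_hom.hom_mult map_poly_monom poly_monom
        of_int_hom.map_poly_hom_smult of_int_hom.map_poly_pCons_hom algebra_simps)
  finally have 1: "of_int ?N - of_int m ^ Suc n * eval_int X b
      = (1 - of_int m * b) * eval_int ?E b" .
  have "m dvd ?N - coeff X (Suc n)"
    using dvd_add[OF EN(2), of "a * m ^ Suc n"] by (simp add: X algebra_simps)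
  with 1 show ?case by blast
qed

text \<open>
  Every conjugate of \<open>(l + 1 / l)\<^sup>2\<close> comes from a conjugate of \<open>l\<close>. The equation
  \<open>(x\<^sup>2 + 1)\<^sup>2 = z x\<^sup>2\<close> expresses \<open>z = (x + 1 / x)\<^sup>2\<close>. The resultant with respect to \<open>x\<close> of \<open>p(x)\<close> and
  this quartic is a rational polynomial in \<open>z\<close> whose zeros are those \<open>z\<close> for which \<open>p\<close> and the quartic
  have a common root. It vanishes at \<open>(l + 1 / l)\<^sup>2\<close>, hence at all conjugates of this number.
\<close>

lemma conjugate_of_joukowski_square:
  fixes l z :: complex
  assumes "irreducible f" "p \<noteq> 0" "l \<noteq> 0" "eval_rat p l = 0"
    and "eval_rat f ((l + 1 / l)\<^sup>2) = 0" "eval_rat f z = 0"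
  shows "\<exists>l'. eval_rat p l' = 0 \<and> (l'\<^sup>2 + 1)\<^sup>2 = z * l'\<^sup>2"
proof -
  define P where "P = map_poly (\<lambda>c. [:c:]) p"
  define G :: "rat poly poly" where "G = [:1, 0, [:2, -1:], 0, 1:]"
  define R where "R = resultant P G"
  have R: "eval_rat R w = resultant (map_poly of_rat p) [:1, 0, 2 - w, 0, 1:]" for w :: complex
  proof -
    interpret ev: comm_ring_hom "\<lambda>q. eval_rat q w" by (rule comm_ring_hom_eval_rat)
    have P': "map_poly (\<lambda>q. eval_rat q w) P = map_poly of_rat p"
      by (intro poly_eqI) (simp add: P_def coeff_map_poly of_rat_hom.map_poly_pCons_hom)
    have G': "map_poly (\<lambda>q. eval_rat q w) G = [:1, 0, 2 - w, 0, 1:]"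
      by (simp add: G_def map_poly_pCons)
    have "degree P = degree p" unfolding P_def by (rule degree_map_poly) auto
    then show ?thesis
      using ev.resultant_map_poly[of P G] unfolding P' G' R_def by (simp add: G_def)
  qed
  have quartic: "poly [:1, 0, 2 - w, 0, 1:] x = (x\<^sup>2 + 1)\<^sup>2 - w * x\<^sup>2" for w x :: complex
    by (simp add: algebra_simps power2_eq_square)
  let ?p = "map_poly of_rat p :: complex poly"
  have "?p \<noteq> 0" using assms(2) by simp
  have "eval_rat R ((l + 1 / l)\<^sup>2) = 0"
  proof -
    let ?g = "[:1, 0, 2 - (l + 1 / l)\<^sup>2, 0, 1:]"
    have "(l + 1 / l) * l = l\<^sup>2 + 1"
      using assms(3) by (simp add: distrib_right power2_eq_square)
    then have "poly ?g l = 0" unfolding quartic power_mult_distrib[symmetric] by simp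
    then have "[:- l, 1:] dvd ?g" by (simp only: poly_eq_0_iff_dvd)
    moreover have "[:- l, 1:] dvd ?p" using assms(4) by (simp only: poly_eq_0_iff_dvd)
    ultimately have "[:- l, 1:] dvd gcd ?p ?g" by (rule gcd_greatest[rotated])
    moreover have "gcd ?p ?g \<noteq> 0" using \<open>?p \<noteq> 0\<close> by simp
    ultimately have "degree (gcd ?p ?g) \<ge> 1"
      using dvd_imp_degree_le[of "[:- l, 1:]"] by fastforce
    then show ?thesis unfolding R resultant_0_gcd by simp
  qed
  then have "f dvd R" using irreducible_dvd_if_common_root[OF assms(1,5)] by blast
  then have "eval_rat R z = 0" using assms(6) by (rule eval_rat_eq_0_if_dvd)
  then have "degree (gcd ?p [:1, 0, 2 - z, 0, 1:]) \<noteq> 0" unfolding R resultant_0_gcd .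
  then obtain l' where "poly (gcd ?p [:1, 0, 2 - z, 0, 1:]) l' = 0"
    using fundamental_theorem_of_algebra[of "gcd ?p [:1, 0, 2 - z, 0, 1:]"] unfolding constant_degree by blast
  then have dvd: "[:- l', 1:] dvd gcd ?p [:1, 0, 2 - z, 0, 1:]" by (simp only: poly_eq_0_iff_dvd)
  have "poly ?p l' = 0" "poly [:1, 0, 2 - z, 0, 1:] l' = 0"
    using dvd_trans[OF dvd gcd_dvd1] dvd_trans[OF dvd gcd_dvd2] by (simp_all only: poly_eq_0_iff_dvd)
  then show ?thesis unfolding quartic by auto
qed

lemma eval_rat_of_int_poly: "eval_rat (map_poly of_int P) z = eval_int P z"
  by (simp add: map_poly_map_poly o_def)

lemma eval_rat_of_real: "eval_rat p (of_real x :: complex) = of_real (eval_rat p x)"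
proof -
  have "of_real (of_rat q) = (of_rat q :: complex)" for q by (cases q) (simp add: of_rat_rat)
  then show ?thesis by (simp add: poly_altdef)
qed

lemma algebraic_int_conjugate:
  assumes "irreducible p" "eval_rat p z = 0" "eval_rat p w = 0" "algebraic_int z"
  shows "algebraic_int w"
proof -
  obtain P where P: "eval_int P z = 0" "lead_coeff P = 1"
    using assms(4) by (auto simp: algebraic_int_altdef_ipoly)
  then have "p dvd map_poly of_int P"
    using irreducible_dvd_if_common_root[OF assms(1,2)] by (simp add: eval_rat_of_int_poly)
  then have "eval_int P w = 0"
    using eval_rat_eq_0_if_dvd assms(3) by (metis eval_rat_of_int_poly)
  with P(2) show ?thesis by (auto simp: algebraic_int_altdef_ipoly)
qed

text \<open>
  Otherwise \<open>p\<close> divides the polynomial \<open>x\<close>.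
\<close>

lemma conjugate_nonzero:
  assumes "irreducible p" "eval_rat p z = 0" "eval_rat p w = 0" "z \<noteq> 0"
  shows "w \<noteq> 0"
proof
  assume "w = 0"
  then have "eval_rat [:0, 1:] w = 0" by (simp add: of_rat_hom.map_poly_pCons_hom)
  then have "p dvd [:0, 1:]" by (rule irreducible_dvd_if_common_root[OF assms(1,3)])
  then have "eval_rat [:0, 1:] z = 0" using assms(2) by (rule eval_rat_eq_0_if_dvd)
  then show False using assms(4) by (simp add: of_rat_hom.map_poly_pCons_hom)
qed

text \<open>
  A monic equation for \<open>1 / l\<close>, multiplied by a power of \<open>l\<close>, reads \<open>1 + l W(l) = 0\<close>.
\<close>

lemma inverse_in_int_polys:
  fixes l :: "'a :: field_char_0"
  assumes "algebraic_int (inverse l)" "l \<noteq> 0"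
  shows "\<exists>W. eval_int W l = inverse l"
proof -
  obtain Q where Q: "eval_int Q (inverse l) = 0" "lead_coeff Q = 1"
    using assms(1) by (auto simp: algebraic_int_altdef_ipoly)
  define R where "R = reflect_poly Q"
  have "map_poly of_int R = (reflect_poly (map_poly of_int Q) :: 'a poly)"
    by (intro poly_eqI) (simp add: R_def coeff_reflect_poly)
  then have "eval_int R l = 0" using Q(1) assms(2) by (simp add: poly_reflect_poly_nz)
  moreover obtain a W where R: "R = pCons a W" by (cases R)
  moreover have "a = 1" using Q(2) R by (metis R_def coeff_0_reflect_poly coeff_pCons_0)
  ultimately have "1 + l * eval_int W l = 0" by (simp add: of_int_hom.map_poly_pCons_hom)
  then have "1 = - (l * eval_int W l)" by (simp only: eq_neg_iff_add_eq_0)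
  from this[symmetric] have "l * eval_int (- W) l = 1"
    by (simp only: of_int_poly_hom.hom_uminus poly_minus mult_minus_right)
  then have "eval_int (- W) l = inverse l" by (rule inverse_unique[symmetric])
  then show ?thesis by blast
qed

lemma algebraic_unit_conjugate:
  fixes z w :: "'a :: field_char_0"
  assumes "irreducible p" "eval_rat p z = 0" "eval_rat p w = 0" "algebraic_unit z"
  shows "algebraic_unit w"
proof -
  have z: "z \<noteq> 0" "algebraic_int z" "algebraic_int (inverse z)" using assms(4) by (auto simp: algebraic_unit_def)
  have w: "w \<noteq> 0" using conjugate_nonzero[OF assms(1-3) z(1)] .
  obtain Q where Q: "eval_int Q (inverse z) = 0" "lead_coeff Q = 1"
    using z(3) by (auto simp: algebraic_int_altdef_ipoly)
  let ?R = "reflect_poly (map_poly of_int Q :: rat poly)"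
  have R: "map_poly of_rat ?R = (reflect_poly (map_poly of_int Q) :: 'a poly)"
    by (intro poly_eqI) (simp add: coeff_reflect_poly)
  have "eval_rat ?R z = 0" using Q(1) z(1) unfolding R by (simp add: poly_reflect_poly_nz)
  then have "p dvd ?R" by (rule irreducible_dvd_if_common_root[OF assms(1,2)])
  then have "eval_rat ?R w = 0" using assms(3) by (rule eval_rat_eq_0_if_dvd)
  then have "eval_int Q (inverse w) = 0" using w unfolding R by (simp add: poly_reflect_poly_nz)
  with Q(2) have "algebraic_int (inverse w)" by (auto simp: algebraic_int_altdef_ipoly)
  then show ?thesis
    using w algebraic_int_conjugate[OF assms(1-3) z(2)] by (simp add: algebraic_unit_def)
qed

text \<open>
  For a unit, \<open>1 / l \<in> \<int>[l]\<close>, so that \<open>l + 1 / l\<close> is a value of an integral polynomial at \<open>l\<close>.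
\<close>

lemma algebraic_int_joukowski_square:
  fixes l :: "'a :: field_char_0"
  assumes "algebraic_unit l"
  shows "algebraic_int ((l + 1 / l)\<^sup>2)"
proof -
  obtain W where "eval_int W l = inverse l"
    using inverse_in_int_polys assms by (auto simp: algebraic_unit_def)
  then have eq: "(l + 1 / l)\<^sup>2 = eval_int (([:0, 1:] + W)\<^sup>2) l"
    by (simp add: of_int_poly_hom.hom_add of_int_poly_hom.hom_power inverse_eq_divide of_int_hom.map_poly_pCons_hom)
  show ?thesis unfolding eq using assms by (intro algebraic_int_eval_int) (simp add: algebraic_unit_def)
qed

section \<open>Branch sums\<close>

text \<open>
  Think of \<open>s\<close> as the sum over the neighbours of the root of a solution of the eigenvalue equations
  for \<open>\<alpha>\<close>, normalised to 1 at the root, where the equation at the root itself is not imposed. Hanging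
  a second rooted tree with sum \<open>t\<close> below the root forces the value \<open>\<tau>\<close> at the second root to satisfy
  \<open>\<tau> t + 1 = \<alpha> \<tau>\<close>, and so adds \<open>\<tau> = 1 / (\<alpha> - t)\<close> to the sum.
\<close>

inductive_set branch_sums :: "real \<Rightarrow> real set" for \<alpha> :: real where
  zero: "0 \<in> branch_sums \<alpha>"
| graft: "s \<in> branch_sums \<alpha> \<Longrightarrow> t \<in> branch_sums \<alpha> \<Longrightarrow> t \<noteq> \<alpha> \<Longrightarrow>
          s + 1 / (\<alpha> - t) \<in> branch_sums \<alpha>"

lemma branch_sums_add:
  assumes "s \<in> branch_sums \<alpha>" "t \<in> branch_sums \<alpha>"
  shows "s + t \<in> branch_sums \<alpha>"
  using assms(2)
proof induction
  case (graft t u)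
  then show ?case using branch_sums.graft[of "s + t" \<alpha> u] by (simp add: add.assoc)
qed (use assms(1) in simp)

lemma branch_sums_inverse:
  assumes "t \<in> branch_sums \<alpha>" "t \<noteq> \<alpha>"
  shows "1 / (\<alpha> - t) \<in> branch_sums \<alpha>"
  using branch_sums.graft[OF branch_sums.zero assms] by simp

lemma branch_sums_of_nat_mult:
  assumes "s \<in> branch_sums \<alpha>"
  shows "of_nat n * s \<in> branch_sums \<alpha>"
  by (induction n) (auto simp: branch_sums.zero algebra_simps intro: branch_sums_add assms)

section \<open>Rational relations between vectors close to a simplex\<close>

text \<open>
  More unknowns than equations: Gaussian elimination of one equation with the help of one unknown.
\<close>

lemma nontrivial_solution:
  fixes v :: "'j \<Rightarrow> nat \<Rightarrow> 'a :: field"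
  assumes "finite J" "card J > d"
  shows "\<exists>k. (\<exists>j\<in>J. k j \<noteq> 0) \<and> (\<forall>i<d. (\<Sum>j\<in>J. k j * v j i) = 0)"
  using assms
proof (induction d arbitrary: J v)
  case 0
  then have "J \<noteq> {}" by auto
  then show ?case by (intro exI[of _ "\<lambda>_. 1"]) auto
next
  case (Suc d)
  show ?case
  proof (cases "\<exists>j\<in>J. v j d \<noteq> 0")
    case False
    with Suc.IH[of J v] Suc.prems show ?thesis by (auto simp: less_Suc_eq)
  next
    case True
    then obtain j0 where j0: "j0 \<in> J" "v j0 d \<noteq> 0" by blast
    let ?J = "J - {j0}"
    let ?w = "\<lambda>j i. v j i - v j d / v j0 d * v j0 i"
    have "finite ?J" "card ?J > d" using Suc.prems j0 by auto
    from Suc.IH[OF this, of ?w] obtain k where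
      k: "\<exists>j\<in>?J. k j \<noteq> 0" "\<And>i. i < d \<Longrightarrow> (\<Sum>j\<in>?J. k j * ?w j i) = 0" by blast
    define k' where "k' = k(j0 := - (\<Sum>j\<in>?J. k j * v j d) / v j0 d)"
    have split: "(\<Sum>j\<in>J. k' j * v j i) = (\<Sum>j\<in>?J. k j * ?w j i)" for i
    proof -
      have "(\<Sum>j\<in>J. k' j * v j i) = k' j0 * v j0 i + (\<Sum>j\<in>?J. k' j * v j i)"
        using Suc.prems(1) j0(1) by (rule sum.remove)
      also have "(\<Sum>j\<in>?J. k' j * v j i) = (\<Sum>j\<in>?J. k j * v j i)"
        by (intro sum.cong) (auto simp: k'_def)
      also have "k' j0 * v j0 i = - (\<Sum>j\<in>?J. k j * (v j d / v j0 d * v j0 i))"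
        by (simp add: k'_def sum_distrib_left sum_distrib_right sum_divide_distrib ac_simps)
      finally show ?thesis by (simp add: sum_subtractf right_diff_distrib)
    qed
    have "(\<Sum>j\<in>J. k' j * v j i) = 0" if "i < Suc d" for i
      using that k(2)[of i] j0(2) unfolding split by (cases "i = d") auto
    moreover have "\<exists>j\<in>J. k' j \<noteq> 0" using k(1) by (auto simp: k'_def)
    ultimately show ?thesis by blast
  qed
qed

text \<open>
  The polynomials modulo \<open>f\<close> form a rational vector space of dimension \<open>degree f\<close>, and the values at
  roots of \<open>f\<close> only depend on residues.
\<close>

lemma rational_relation_of_values:
  fixes f :: "rat poly" and p :: "'j \<Rightarrow> rat poly" and Z :: "'a :: field_char_0 set"
  assumes "finite J" "card J > degree f" "degree f > 0" "\<And>z. z \<in> Z \<Longrightarrow> eval_rat f z = 0"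
  shows "\<exists>k. (\<exists>j\<in>J. k j \<noteq> 0) \<and> (\<forall>z\<in>Z. (\<Sum>j\<in>J. of_rat (k j) * eval_rat (p j) z) = 0)"
proof -
  obtain k where k: "\<exists>j\<in>J. k j \<noteq> 0"
      "\<And>i. i < degree f \<Longrightarrow> (\<Sum>j\<in>J. k j * coeff (p j mod f) i) = 0"
    using nontrivial_solution[OF assms(1,2), of "\<lambda>j. coeff (p j mod f)"] by blast
  have deg: "degree (p j mod f) < degree f" for j
    using assms(3) degree_mod_less[of f "p j"] by fastforce
  have "(\<Sum>j\<in>J. Polynomial.smult (k j) (p j mod f)) = 0"
  proof (rule poly_eqI)
    fix i
    show "coeff (\<Sum>j\<in>J. Polynomial.smult (k j) (p j mod f)) i = coeff 0 i"
    proof (cases "i < degree f")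
      case True
      then show ?thesis using k(2) by (simp add: coeff_sum)
    next
      case False
      then have "coeff (p j mod f) i = 0" for j
        using deg[of j] by (intro coeff_eq_0) linarith
      then show ?thesis by (simp add: coeff_sum)
    qed
  qed
  then have *: "eval_rat (\<Sum>j\<in>J. Polynomial.smult (k j) (p j mod f)) z = 0" for z :: 'a by simp
  have "(\<Sum>j\<in>J. of_rat (k j) * eval_rat (p j) z) = 0" if "z \<in> Z" for z
  proof -
    have "eval_rat (p j) z = eval_rat (p j mod f) z" for j
    proof -
      have "eval_rat (p j) z = eval_rat (p j div f * f + p j mod f) z" by simp
      then show ?thesis
        using assms(4)[OF that] by (simp only: of_rat_poly_hom.hom_add of_rat_poly_hom.hom_mult) simp
    qed
    then show ?thesis
      using *[of z] by (simp add: of_rat_poly_hom.hom_sum poly_sum of_rat_hom.map_poly_hom_smult)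
  qed
  with k(1) show ?thesis by blast
qed

text \<open>
  The relations between the vectors \<open>(-1, \<dots>, -1)\<close> and the standard basis vectors are the multiples
  of the one with all coefficients equal to 1. For vectors nearby, comparing coordinates shows that
  the coefficients of any relation differ by less than the largest of their absolute values, which
  fixes their sign.
\<close>

lemma same_sign_if_nearly_simplex:
  fixes x :: "'j \<Rightarrow> 'j \<Rightarrow> real"
  assumes "finite Z" "e \<notin> Z"
    and near_e: "\<And>z. z \<in> Z \<Longrightarrow> \<bar>x e z + 1\<bar> \<le> 1 / (4 * (card Z + 1))"
    and near: "\<And>j z. j \<in> Z \<Longrightarrow> z \<in> Z \<Longrightarrow> \<bar>x j z - of_bool (j = z)\<bar> \<le> 1 / (4 * (card Z + 1))"
    and rel: "\<And>z. z \<in> Z \<Longrightarrow> (\<Sum>j\<in>insert e Z. c j * x j z) = 0"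
    and nz: "\<exists>j\<in>insert e Z. c j \<noteq> 0"
  shows "(\<forall>j\<in>insert e Z. c j > 0) \<or> (\<forall>j\<in>insert e Z. c j < 0)"
proof -
  let ?J = "insert e Z"
  define M where "M = Max ((\<lambda>j. \<bar>c j\<bar>) ` ?J)"
  have fin: "finite ?J" using assms(1) by simp
  have M: "\<bar>c j\<bar> \<le> M" if "j \<in> ?J" for j
    unfolding M_def using fin that by (intro Max_ge) auto
  have "M \<in> (\<lambda>j. \<bar>c j\<bar>) ` ?J" unfolding M_def using fin by (intro Max_in) auto
  then obtain i where i: "M = \<bar>c i\<bar>" "i \<in> ?J" by (rule imageE)
  have "M > 0"
  proof -
    from nz obtain j where "j \<in> ?J" "c j \<noteq> 0" by blast
    then show ?thesis using M[of j] by linarith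
  qed
  \<comment> \<open>The coordinate \<open>z\<close> of the relation between the unperturbed vectors would be \<open>c z - c e\<close>.\<close>
  have close_e: "\<bar>c z - c e\<bar> \<le> M / 4" if z: "z \<in> Z" for z
  proof -
    let ?d = "\<lambda>j. (if j = e then -1 else of_bool (j = z)) :: real"
    have "(\<Sum>j\<in>?J. c j * ?d j) = - c e + (\<Sum>j\<in>Z. c j * ?d j)"
      using assms(1,2) by simp
    also have "(\<Sum>j\<in>Z. c j * ?d j) = c z * ?d z + (\<Sum>j\<in>Z - {z}. c j * ?d j)"
      using assms(1) z by (rule sum.remove)
    also have "(\<Sum>j\<in>Z - {z}. c j * ?d j) = 0"
      using assms(2) by (intro sum.neutral) auto
    also have "- c e + (c z * ?d z + 0) = c z - c e"
      using assms(2) z by auto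
    finally have "c z - c e = (\<Sum>j\<in>?J. c j * ?d j) - (\<Sum>j\<in>?J. c j * x j z)"
      using rel[OF z] by simp
    also have "\<dots> = (\<Sum>j\<in>?J. c j * (?d j - x j z))"
      unfolding sum_subtractf[symmetric] right_diff_distrib ..
    also have "\<bar>\<dots>\<bar> \<le> (\<Sum>j\<in>?J. M * (1 / (4 * (card Z + 1))))"
    proof (rule order.trans[OF sum_abs], rule sum_mono)
      fix j assume j: "j \<in> ?J"
      have "\<bar>?d j - x j z\<bar> \<le> 1 / (4 * (card Z + 1))"
        using near_e[OF z] near[of j z] z j assms(2) by (cases "j = e") (auto simp: abs_minus_commute)
      then show "\<bar>c j * (?d j - x j z)\<bar> \<le> M * (1 / (4 * (card Z + 1)))"
        unfolding abs_mult using M[OF j] \<open>M > 0\<close> by (intro mult_mono) auto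
    qed
    also have "\<dots> = M / 4" using assms(1,2) by (simp add: field_simps)
    finally show ?thesis .
  qed
  have close: "\<bar>c j - c i\<bar> < M" if j: "j \<in> ?J" for j
  proof -
    have "\<bar>c j - c e\<bar> \<le> M / 4" "\<bar>c i - c e\<bar> \<le> M / 4"
      using close_e j i(2) \<open>M > 0\<close> by auto
    then show ?thesis using \<open>M > 0\<close> by linarith
  qed
  show ?thesis
  proof (cases "c i > 0")
    case True
    then have "c j > 0" if "j \<in> ?J" for j using close[OF that] i(1) by linarith
    then show ?thesis by blast
  next
    case False
    then have "c j < 0" if "j \<in> ?J" for j using close[OF that] i(1) by linarith
    then show ?thesis by blast
  qed
qed

lemma common_multiple_nat:
  fixes k :: "'j \<Rightarrow> rat"
  assumes "finite J" "\<And>j. j \<in> J \<Longrightarrow> k j \<ge> 0"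
  shows "\<exists>m > 0. \<forall>j\<in>J. \<exists>n. of_nat m * k j = of_nat n"
  using assms
proof (induction J)
  case empty
  then show ?case by (intro exI[of _ 1]) auto
next
  case (insert i J)
  then obtain m where m: "m > 0" "\<And>j. j \<in> J \<Longrightarrow> \<exists>n. of_nat m * k j = of_nat n" by auto
  obtain a b where ab: "quotient_of (k i) = (a, b)" by fastforce
  then have b: "b > 0" "k i = of_int a / of_int b"
    by (auto simp: quotient_of_denom_pos quotient_of_div)
  with insert.prems[of i] have a: "a \<ge> 0" by (auto simp: zero_le_divide_iff)
  have "of_nat (m * nat b) * k i = of_nat (m * nat a)"
    using a b by (simp add: field_simps)
  moreover have "\<exists>n. of_nat (m * nat b) * k j = of_nat n" if "j \<in> J" for j
  proof -
    from m(2)[OF that] obtain n where "of_nat m * k j = of_nat n" by blast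
    then have "of_nat (m * nat b) * k j = of_nat (nat b * n)" by (simp add: algebra_simps)
    then show ?thesis by blast
  qed
  ultimately have "\<forall>j\<in>insert i J. \<exists>n. of_nat (m * nat b) * k j = of_nat n" by blast
  then show ?case using m(1) b(1) by (intro exI[of _ "m * nat b"]) simp
qed

section \<open>Totally real algebraic integers are branch sums\<close>

text \<open>
  The situation to be refuted. The polynomial \<open>f\<close> is a minimal polynomial of \<open>\<alpha>\<^sup>2\<close>, and \<open>\<alpha>\<close> totally real
  means that the conjugates of \<open>\<alpha>\<^sup>2\<close> are positive. Working with \<open>\<alpha>\<^sup>2\<close> is forced: as a tree is
  bipartite, its branch sums are odd in \<open>\<alpha>\<close>, hence of the form \<open>\<alpha> p(\<alpha>\<^sup>2)\<close>.
\<close>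

locale missing_tree_eigenvalue =
  fixes \<alpha> :: real and f :: "rat poly"
  assumes \<alpha>_nonzero: "\<alpha> \<noteq> 0"
    and irred: "irreducible f"
    and root: "eval_rat f (\<alpha>\<^sup>2) = 0"
    and pos: "\<And>z :: complex. eval_rat f z = 0 \<Longrightarrow> \<exists>x > 0. z = of_real x"
    and missing: "\<alpha> \<notin> branch_sums \<alpha>"
begin

definition roots :: "real set" where "roots = {z. eval_rat f z = 0}"

definition branch_polys :: "rat poly set" where "branch_polys = {p. \<alpha> * eval_rat p (\<alpha>\<^sup>2) \<in> branch_sums \<alpha>}"

lemma complex_roots: "{z :: complex. eval_rat f z = 0} = of_real ` roots"
  using pos by (force simp: roots_def eval_rat_of_real)

lemma card_roots: "card roots = degree f"
  using card_roots_irreducible[OF irred] unfolding complex_roots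
  by (simp add: card_image inj_on_def)

lemma finite_roots: "finite roots"
  using card_roots irreducible_degree_pos[OF irred] by (intro card_ge_0_finite) simp

lemma roots_pos: "z \<in> roots \<Longrightarrow> z > 0"
  using pos[of "of_real z"] by (auto simp: roots_def eval_rat_of_real)

lemma square_in_roots: "\<alpha>\<^sup>2 \<in> roots"
  using root by (simp add: roots_def)

lemma zero_in_branch_polys: "0 \<in> branch_polys"
  by (simp add: branch_polys_def branch_sums.zero)

lemma add_in_branch_polys: "p \<in> branch_polys \<Longrightarrow> q \<in> branch_polys \<Longrightarrow> p + q \<in> branch_polys"
  by (auto simp: branch_polys_def of_rat_poly_hom.hom_add distrib_left intro: branch_sums_add)

lemma of_nat_mult_in_branch_polys: "p \<in> branch_polys \<Longrightarrow> of_nat n * p \<in> branch_polys"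
  by (induction n) (auto simp: zero_in_branch_polys distrib_right intro: add_in_branch_polys)

lemma sum_in_branch_polys: "(\<And>i. i \<in> I \<Longrightarrow> p i \<in> branch_polys) \<Longrightarrow> sum p I \<in> branch_polys"
  by (induction I rule: infinite_finite_induct) (auto simp: zero_in_branch_polys intro: add_in_branch_polys)

lemma eval_of_nat_mult: "eval_rat (of_nat n * p) z = of_nat n * eval_rat p z"
  by (simp add: of_rat_poly_hom.hom_mult of_nat_poly of_rat_hom.map_poly_pCons_hom
      of_rat_hom.map_poly_hom_smult)

text \<open>
  With \<open>s = \<alpha> p(\<alpha>\<^sup>2)\<close>, the branch sum \<open>1 / (\<alpha> - s)\<close> is \<open>\<alpha> r(\<alpha>\<^sup>2)\<close> for an inverse \<open>r\<close> of \<open>x (1 - p)\<close>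
  modulo \<open>f\<close>. Such an inverse exists because \<open>\<alpha>\<close> is not a branch sum, and it is an inverse at all
  conjugates simultaneously.
\<close>

lemma inverse_in_branch_polys:
  assumes "p \<in> branch_polys"
  shows "\<exists>r\<in>branch_polys. \<forall>z\<in>roots. eval_rat r z = 1 / (z * (1 - eval_rat p z))"
proof -
  let ?q = "[:0, 1:] * (1 - p)"
  have q: "eval_rat ?q z = z * (1 - eval_rat p z)" for z :: real
    by (simp only: of_rat_poly_hom.hom_mult of_rat_poly_hom.hom_minus) (simp add: of_rat_hom.map_poly_pCons_hom)
  have "eval_rat p (\<alpha>\<^sup>2) \<noteq> 1" using assms missing by (auto simp: branch_polys_def)
  then have "eval_rat ?q (\<alpha>\<^sup>2) \<noteq> 0" using \<alpha>_nonzero unfolding q by simp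
  then have "\<not> f dvd ?q" using eval_rat_eq_0_if_dvd root by blast
  then have "coprime f ?q"
    using irred by (meson comm_semiring_1_class.irreducibleD' coprime_def dvd_trans)
  then obtain u r where "u * f + r * ?q = 1"
    by (metis bezout_coefficients_fst_snd coprime_imp_gcd_eq_1)
  then have bezout: "eval_rat (u * f + r * ?q) z = 1" for z :: real by simp
  have *: "eval_rat r z * eval_rat ?q z = 1" if "z \<in> roots" for z
    using that bezout[of z] by (simp only: of_rat_poly_hom.hom_add of_rat_poly_hom.hom_mult poly_add poly_mult) (simp add: roots_def)
  have val: "eval_rat r z = 1 / (z * (1 - eval_rat p z))" if "z \<in> roots" for z
    using *[OF that] unfolding q by (metis nonzero_eq_divide_eq mult_zero_right zero_neq_one)
  have "\<alpha>\<^sup>2 * (1 - eval_rat p (\<alpha>\<^sup>2)) = \<alpha> * (\<alpha> - \<alpha> * eval_rat p (\<alpha>\<^sup>2))"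
    by (simp add: power2_eq_square right_diff_distrib)
  then have "\<alpha> * eval_rat r (\<alpha>\<^sup>2) = 1 / (\<alpha> - \<alpha> * eval_rat p (\<alpha>\<^sup>2))"
    using val[OF square_in_roots] \<alpha>_nonzero by simp
  moreover have "\<dots> \<in> branch_sums \<alpha>"
    using assms missing by (intro branch_sums_inverse) (auto simp: branch_polys_def)
  ultimately have "r \<in> branch_polys" by (simp add: branch_polys_def)
  with val show ?thesis by blast
qed

lemma one_over_in_branch_polys: "\<exists>p\<in>branch_polys. \<forall>z\<in>roots. eval_rat p z = 1 / z"
  using inverse_in_branch_polys[OF zero_in_branch_polys] by simp

text \<open>
  This comes from a star with \<open>n\<close> leaves that hangs below the root.
\<close>

lemma one_over_shift_in_branch_polys: "\<exists>p\<in>branch_polys. \<forall>z\<in>roots. eval_rat p z = 1 / (z - of_nat n)"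
proof -
  obtain p where p: "p \<in> branch_polys" "\<And>z. z \<in> roots \<Longrightarrow> eval_rat p z = 1 / z" using one_over_in_branch_polys by blast
  from inverse_in_branch_polys[OF of_nat_mult_in_branch_polys[OF p(1), of n]] obtain r where
    r: "r \<in> branch_polys" "\<And>z. z \<in> roots \<Longrightarrow> eval_rat r z = 1 / (z * (1 - eval_rat (of_nat n * p) z))" by blast
  have "eval_rat r z = 1 / (z - of_nat n)" if "z \<in> roots" for z
  proof -
    have "z * (1 - real n * (1 / z)) = z - real n" using roots_pos[OF that] by (simp add: field_simps)
    then show ?thesis using r(2) p(2) that by (simp only: eval_of_nat_mult)
  qed
  with r(1) show ?thesis by blast
qed

text \<open>
  As \<open>n\<close> grows, the value at \<open>z\<close> tends to \<open>1 / ((1 + b) z - a)\<close>, a function whose pole is an arbitrary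
  nonnegative rational number.
\<close>

lemma depth_two_in_branch_polys:
  "\<exists>p\<in>branch_polys. \<forall>z\<in>roots. eval_rat p z = 1 / (z - of_nat a - of_nat b * (of_nat n * z / (z - of_nat n)))"
proof -
  obtain p where p: "p \<in> branch_polys" "\<And>z. z \<in> roots \<Longrightarrow> eval_rat p z = 1 / z" using one_over_in_branch_polys by blast
  obtain q where q: "q \<in> branch_polys" "\<And>z. z \<in> roots \<Longrightarrow> eval_rat q z = 1 / (z - of_nat n)"
    using one_over_shift_in_branch_polys by blast
  let ?s = "of_nat a * p + of_nat (b * n) * q"
  have "?s \<in> branch_polys" using p(1) q(1) by (intro add_in_branch_polys of_nat_mult_in_branch_polys)
  from inverse_in_branch_polys[OF this] obtain r where
    r: "r \<in> branch_polys" "\<And>z. z \<in> roots \<Longrightarrow> eval_rat r z = 1 / (z * (1 - eval_rat ?s z))" by blast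
  have "eval_rat r z = 1 / (z - of_nat a - of_nat b * (of_nat n * z / (z - of_nat n)))" if "z \<in> roots" for z
  proof -
    have "eval_rat ?s z = real a / z + real b * real n / (z - real n)"
      using p(2) q(2) that unfolding of_rat_poly_hom.hom_add poly_add eval_of_nat_mult by simp
    then have "z * (1 - eval_rat ?s z) = z - real a - real b * (real n * z / (z - real n))"
      using roots_pos[OF that] by (simp add: right_diff_distrib distrib_left)
    then show ?thesis using r(2)[OF that] by simp
  qed
  with r(1) show ?thesis by blast
qed

text \<open>
  For large \<open>n\<close>, \<open>n / (z - n)\<close> is close to \<open>-1\<close>.
\<close>

lemma approx_minus_one:
  assumes "\<epsilon> > 0"
  shows "\<exists>p\<in>branch_polys. \<exists>c > 0. \<forall>z\<in>roots. \<bar>c * eval_rat p z + 1\<bar> < \<epsilon>"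
proof -
  have "\<forall>\<^sub>F n in sequentially. \<bar>real n * (1 / (z - real n)) + 1\<bar> < \<epsilon>" for z
  proof -
    have "(\<lambda>n. real n * (1 / (z - real n)) + 1) \<longlonglongrightarrow> 0" by real_asymp
    from tendstoD[OF this assms] show ?thesis by (simp add: dist_real_def)
  qed
  then have "\<forall>\<^sub>F n in sequentially. \<forall>z\<in>roots. \<bar>real n * (1 / (z - real n)) + 1\<bar> < \<epsilon>"
    using finite_roots by (simp add: eventually_ball_finite)
  then have "\<forall>\<^sub>F n in sequentially. n > 0 \<and> (\<forall>z\<in>roots. \<bar>real n * (1 / (z - real n)) + 1\<bar> < \<epsilon>)"
    using eventually_gt_at_top[of 0] by eventually_elim auto
  then obtain n where n: "n > 0" "\<And>z. z \<in> roots \<Longrightarrow> \<bar>real n * (1 / (z - real n)) + 1\<bar> < \<epsilon>"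
    using eventually_happens'[OF sequentially_bot] by blast
  obtain p where p: "p \<in> branch_polys" "\<And>z. z \<in> roots \<Longrightarrow> eval_rat p z = 1 / (z - real n)"
    using one_over_shift_in_branch_polys by blast
  from n p show ?thesis by (intro bexI[of _ p] exI[of _ "real n"]) auto
qed

lemma exists_rational_pole:
  assumes "z0 \<in> roots" "\<epsilon> > 0"
  shows "\<exists>a b :: nat. b > 0 \<and> real a / real b < z0 \<and>
           (\<forall>w\<in>roots. w \<noteq> z0 \<longrightarrow> w \<noteq> real a / real b \<and> \<bar>(z0 - real a / real b) / (w - real a / real b)\<bar> < \<epsilon>)"
proof -
  have "\<forall>\<^sub>F t in at_left z0. w \<noteq> z0 \<longrightarrow> w \<noteq> t \<and> \<bar>(z0 - t) / (w - t)\<bar> < \<epsilon>" for w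
  proof (cases "w = z0")
    case False
    have "((\<lambda>t. w - t) \<longlongrightarrow> w - z0) (at_left z0)" by (intro tendsto_intros)
    from tendsto_imp_eventually_ne[OF this, of 0] False
    have 1: "\<forall>\<^sub>F t in at_left z0. w - t \<noteq> 0" by simp
    have "((\<lambda>t. (z0 - t) / (w - t)) \<longlongrightarrow> (z0 - z0) / (w - z0)) (at_left z0)"
      using False by (intro tendsto_intros) auto
    from tendstoD[OF this assms(2)]
    have "\<forall>\<^sub>F t in at_left z0. \<bar>(z0 - t) / (w - t)\<bar> < \<epsilon>" by (simp add: dist_real_def)
    with 1 show ?thesis by eventually_elim auto
  qed simp
  then have "\<forall>\<^sub>F t in at_left z0. \<forall>w\<in>roots. w \<noteq> z0 \<longrightarrow> w \<noteq> t \<and> \<bar>(z0 - t) / (w - t)\<bar> < \<epsilon>"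
    using finite_roots by (simp add: eventually_ball_finite)
  then obtain b where b: "b < z0"
      "\<And>t. b < t \<Longrightarrow> t < z0 \<Longrightarrow> \<forall>w\<in>roots. w \<noteq> z0 \<longrightarrow> w \<noteq> t \<and> \<bar>(z0 - t) / (w - t)\<bar> < \<epsilon>"
    unfolding eventually_at_left_field by blast
  have "max b 0 < z0" using b(1) roots_pos[OF assms(1)] by simp
  then obtain t where t: "t \<in> \<rat>" "max b 0 < t" "t < z0" using Rats_dense_in_real by blast
  then obtain m n :: nat where mn: "n \<noteq> 0" "\<bar>t\<bar> = real m / real n" by (metis Rats_abs_nat_div_natE)
  then have "t = real m / real n" using t(2) by simp
  moreover have "t < z0 \<and> (\<forall>w\<in>roots. w \<noteq> z0 \<longrightarrow> w \<noteq> t \<and> \<bar>(z0 - t) / (w - t)\<bar> < \<epsilon>)"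
    using b(2)[of t] t by simp
  ultimately show ?thesis using mn(1) by blast
qed

text \<open>
  A function \<open>(z0 - \<tau>) / (z - \<tau>)\<close> with its pole \<open>\<tau>\<close> just below \<open>z0\<close> equals 1 at \<open>z0\<close> and is small at the
  other roots of \<open>f\<close>.
\<close>

lemma approx_indicator:
  assumes "z0 \<in> roots" "\<epsilon> > 0"
  shows "\<exists>p\<in>branch_polys. \<exists>c > 0. \<forall>z\<in>roots. \<bar>c * eval_rat p z - of_bool (z0 = z)\<bar> < \<epsilon>"
proof -
  obtain a b :: nat where b: "b > 0" and lt: "real a / real b < z0"
    and ab: "\<And>w. w \<in> roots \<Longrightarrow> w \<noteq> z0 \<Longrightarrow> w \<noteq> real a / real b \<and>
      \<bar>(z0 - real a / real b) / (w - real a / real b)\<bar> < \<epsilon>"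
    using exists_rational_pole[OF assms] by blast
  define \<tau> where "\<tau> = real a / real b"
  define c where "c = real b * (z0 - \<tau>)"
  have c: "c > 0" using b lt by (simp add: c_def \<tau>_def)
  obtain d where d: "b = Suc d" using b by (cases b) auto
  let ?g = "\<lambda>n z. 1 / (z - real a - real d * (real n * z / (z - real n)))"
  have "\<forall>\<^sub>F n in sequentially. \<bar>c * ?g n z - of_bool (z0 = z)\<bar> < \<epsilon>" if z: "z \<in> roots" for z
  proof -
    have ne: "z \<noteq> \<tau>" using ab[OF z] lt by (cases "z = z0") (auto simp: \<tau>_def)
    have bt: "real a = real b * \<tau>" using b by (simp add: \<tau>_def)
    have lim: "(\<lambda>n. real n * z / (z - real n)) \<longlonglongrightarrow> - z" by real_asymp
    have eq: "z - real a - real d * (- z) = real b * (z - \<tau>)"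
      unfolding bt by (simp add: d algebra_simps)
    with ne b have "z - real a - real d * (- z) \<noteq> 0" by simp
    then have "(\<lambda>n. c * ?g n z) \<longlonglongrightarrow> c * (1 / (z - real a - real d * (- z)))"
      by (intro tendsto_intros lim)
    also note eq
    also have "c * (1 / (real b * (z - \<tau>))) = (z0 - \<tau>) / (z - \<tau>)"
      using b by (simp add: c_def)
    finally have "(\<lambda>n. c * ?g n z - of_bool (z0 = z)) \<longlonglongrightarrow> (z0 - \<tau>) / (z - \<tau>) - of_bool (z0 = z)"
      by (intro tendsto_intros)
    then have "(\<lambda>n. \<bar>c * ?g n z - of_bool (z0 = z)\<bar>) \<longlonglongrightarrow> \<bar>(z0 - \<tau>) / (z - \<tau>) - of_bool (z0 = z)\<bar>"
      by (rule tendsto_rabs)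
    moreover have "\<bar>(z0 - \<tau>) / (z - \<tau>) - of_bool (z0 = z)\<bar> < \<epsilon>"
      using ab[OF z] ne assms(2) by (cases "z = z0") (auto simp: \<tau>_def)
    ultimately show ?thesis by (rule order_tendstoD(2))
  qed
  then have "\<forall>\<^sub>F n in sequentially. \<forall>z\<in>roots. \<bar>c * ?g n z - of_bool (z0 = z)\<bar> < \<epsilon>"
    using finite_roots by (simp add: eventually_ball_finite)
  then obtain n where n: "\<And>z. z \<in> roots \<Longrightarrow> \<bar>c * ?g n z - of_bool (z0 = z)\<bar> < \<epsilon>"
    using eventually_happens'[OF sequentially_bot] by blast
  obtain p where p: "p \<in> branch_polys" "\<And>z. z \<in> roots \<Longrightarrow> eval_rat p z = ?g n z"
    using depth_two_in_branch_polys by blast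
  from n p c show ?thesis by (intro bexI[of _ p] exI[of _ c]) auto
qed

text \<open>
  Adding \<open>v\<close> to a large multiple of an approximation of \<open>(-1, \<dots>, -1)\<close> does not change its direction
  much. The \<open>d + 1\<close> resulting vectors in a space of dimension \<open>d\<close> have a rational relation, whose
  coefficients can be taken to be positive integers; solving it for \<open>- v\<close> exhibits a multiple of \<open>- v\<close>
  as a sum of branch sums.
\<close>

lemma negative_multiple_in_branch_polys: "\<exists>m > 0. of_nat m * - v \<in> branch_polys"
proof -
  define \<epsilon> :: real where "\<epsilon> = 1 / (4 * (card roots + 1))"
  have "\<epsilon> > 0" by (simp add: \<epsilon>_def)
  obtain p0 c0 where p0: "p0 \<in> branch_polys" "c0 > 0" "\<And>z. z \<in> roots \<Longrightarrow> \<bar>c0 * eval_rat p0 z + 1\<bar> < \<epsilon> / 2"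
    using approx_minus_one[of "\<epsilon> / 2"] \<open>\<epsilon> > 0\<close> by auto
  have "\<forall>z0\<in>roots. \<exists>p c. p \<in> branch_polys \<and> c > 0 \<and> (\<forall>z\<in>roots. \<bar>c * eval_rat p z - of_bool (z0 = z)\<bar> < \<epsilon>)"
    using approx_indicator \<open>\<epsilon> > 0\<close> by blast
  then obtain P C where PC: "\<And>z0. z0 \<in> roots \<Longrightarrow> P z0 \<in> branch_polys" "\<And>z0. z0 \<in> roots \<Longrightarrow> C z0 > (0::real)"
      "\<And>z0 z. z0 \<in> roots \<Longrightarrow> z \<in> roots \<Longrightarrow> \<bar>C z0 * eval_rat (P z0) z - of_bool (z0 = z)\<bar> < \<epsilon>"
    by metis
  have "\<forall>\<^sub>F K in sequentially. \<bar>c0 / real K * eval_rat v z\<bar> < \<epsilon> / 2" for z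
  proof -
    have "(\<lambda>K. c0 / real K * eval_rat v z) \<longlonglongrightarrow> 0"
      by (intro tendsto_mult_left_zero lim_const_over_n)
    from tendstoD[OF this, of "\<epsilon> / 2"] \<open>\<epsilon> > 0\<close> show ?thesis by (simp add: dist_real_def)
  qed
  then have "\<forall>\<^sub>F K in sequentially. \<forall>z\<in>roots. \<bar>c0 / real K * eval_rat v z\<bar> < \<epsilon> / 2"
    using finite_roots by (simp add: eventually_ball_finite)
  then have "\<forall>\<^sub>F K in sequentially. K > 0 \<and> (\<forall>z\<in>roots. \<bar>c0 / real K * eval_rat v z\<bar> < \<epsilon> / 2)"
    using eventually_gt_at_top[of 0] by eventually_elim auto
  then obtain K where K: "K > 0" "\<And>z. z \<in> roots \<Longrightarrow> \<bar>c0 / real K * eval_rat v z\<bar> < \<epsilon> / 2"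
    using eventually_happens'[OF sequentially_bot] by blast
  define w where "w = of_nat K * p0 + v"
  \<comment> \<open>As the roots are positive, 0 is free to serve as the index of the vector \<open>w\<close>.\<close>
  have "0 \<notin> roots" using roots_pos by blast
  define Q where "Q = P(0 := w)"
  define D where "D = C(0 := c0 / real K)"
  have D_pos: "D j > 0" if "j \<in> insert 0 roots" for j
    using that PC(2) p0(2) K(1) \<open>0 \<notin> roots\<close> by (auto simp: D_def)
  have near0: "\<bar>D 0 * eval_rat (Q 0) z + 1\<bar> \<le> \<epsilon>" if z: "z \<in> roots" for z
  proof -
    have "eval_rat w z = real K * eval_rat p0 z + eval_rat v z"
      unfolding w_def of_rat_poly_hom.hom_add poly_add eval_of_nat_mult ..
    then have "D 0 * eval_rat (Q 0) z + 1
        = (c0 * eval_rat p0 z + 1) + c0 / real K * eval_rat v z"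
      using K(1) by (simp add: D_def Q_def field_simps)
    then show ?thesis using p0(3)[OF z] K(2)[OF z] by linarith
  qed
  have near: "\<bar>D j * eval_rat (Q j) z - of_bool (j = z)\<bar> \<le> \<epsilon>" if "j \<in> roots" "z \<in> roots" for j z
    using PC(3)[OF that] that \<open>0 \<notin> roots\<close> by (auto simp: D_def Q_def)
  have "card (insert 0 roots) > degree f" using finite_roots \<open>0 \<notin> roots\<close> card_roots by simp
  moreover have "finite (insert 0 roots)" using finite_roots by simp
  moreover have "eval_rat f z = 0" if "z \<in> roots" for z using that by (simp add: roots_def)
  ultimately have "\<exists>k. (\<exists>j\<in>insert 0 roots. k j \<noteq> 0) \<and>
      (\<forall>z\<in>roots. (\<Sum>j\<in>insert 0 roots. of_rat (k j) * eval_rat (Q j) z) = 0)"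
    using irreducible_degree_pos[OF irred] by (intro rational_relation_of_values)
  then obtain k where k: "\<exists>j\<in>insert 0 roots. k j \<noteq> 0"
      "\<And>z. z \<in> roots \<Longrightarrow> (\<Sum>j\<in>insert 0 roots. of_rat (k j) * eval_rat (Q j) z) = 0"
    by blast
  have "(\<forall>j\<in>insert 0 roots. of_rat (k j) / D j > 0) \<or> (\<forall>j\<in>insert 0 roots. of_rat (k j) / D j < 0)"
  proof (rule same_sign_if_nearly_simplex[where x = "\<lambda>j z. D j * eval_rat (Q j) z"])
    fix z assume "z \<in> roots"
    have "(\<Sum>j\<in>insert 0 roots. of_rat (k j) / D j * (D j * eval_rat (Q j) z))
        = (\<Sum>j\<in>insert 0 roots. of_rat (k j) * eval_rat (Q j) z)"
    proof (intro sum.cong refl)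
      fix j assume "j \<in> insert 0 roots"
      from D_pos[OF this] show "of_rat (k j) / D j * (D j * eval_rat (Q j) z)
          = of_rat (k j) * eval_rat (Q j) z" by simp
    qed
    then show "(\<Sum>j\<in>insert 0 roots. of_rat (k j) / D j * (D j * eval_rat (Q j) z)) = 0"
      using k(2)[OF \<open>z \<in> roots\<close>] by simp
  next
    show "\<exists>j\<in>insert 0 roots. of_rat (k j) / D j \<noteq> 0"
      using k(1) D_pos by fastforce
  qed (use finite_roots \<open>0 \<notin> roots\<close> near0 near in \<open>auto simp: \<epsilon>_def\<close>)
  then have "(\<forall>j\<in>insert 0 roots. 1 * k j > 0) \<or> (\<forall>j\<in>insert 0 roots. - 1 * k j > 0)"
  proof (elim disjE)
    assume *: "\<forall>j\<in>insert 0 roots. of_rat (k j) / D j > 0"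
    have "1 * k j > 0" if "j \<in> insert 0 roots" for j
      using *[rule_format, OF that] D_pos[OF that] by (simp add: zero_less_divide_iff)
    then show ?thesis by blast
  next
    assume *: "\<forall>j\<in>insert 0 roots. of_rat (k j) / D j < 0"
    have "- 1 * k j > 0" if "j \<in> insert 0 roots" for j
      using *[rule_format, OF that] D_pos[OF that] by (simp add: divide_less_0_iff)
    then show ?thesis by blast
  qed
  then obtain s :: rat where s: "\<And>j. j \<in> insert 0 roots \<Longrightarrow> s * k j > 0" by blast
  obtain M where M: "M > 0" "\<And>j. j \<in> insert 0 roots \<Longrightarrow> \<exists>n. of_nat M * (s * k j) = of_nat n"
    using common_multiple_nat[of "insert 0 roots" "\<lambda>j. s * k j"] finite_roots s by (metis finite_insert less_imp_le)
  then obtain N where N: "\<And>j. j \<in> insert 0 roots \<Longrightarrow> of_nat M * (s * k j) = of_nat (N j)" by metis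
  have "N 0 > 0"
    using N[of 0] s[of 0] M(1) by (metis insertI1 mult_pos_pos of_nat_0_less_iff)
  let ?r = "of_nat (N 0 * K) * p0 + (\<Sum>j\<in>roots. of_nat (N j) * P j)"
  have "?r \<in> branch_polys" using p0(1) PC(1) by (intro add_in_branch_polys sum_in_branch_polys of_nat_mult_in_branch_polys)
  have "eval_rat (of_nat (N 0) * - v) z = eval_rat ?r z" if z: "z \<in> roots" for z
  proof -
    have real_N: "real (N j) = of_rat (of_nat M * s) * of_rat (k j)" if "j \<in> insert 0 roots" for j
    proof -
      have "real (N j) = of_rat (of_nat M * (s * k j))" unfolding N[OF that] by simp
      then show ?thesis by (simp add: of_rat_mult)
    qed
    have "(\<Sum>j\<in>insert 0 roots. real (N j) * eval_rat (Q j) z)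
        = of_rat (of_nat M * s) * (\<Sum>j\<in>insert 0 roots. of_rat (k j) * eval_rat (Q j) z)"
      unfolding sum_distrib_left using real_N by (intro sum.cong) auto
    then have "0 = (\<Sum>j\<in>insert 0 roots. real (N j) * eval_rat (Q j) z)"
      using k(2)[OF z] by simp
    also have "\<dots> = real (N 0) * eval_rat w z + (\<Sum>j\<in>roots. real (N j) * eval_rat (Q j) z)"
      using finite_roots \<open>0 \<notin> roots\<close> by (simp add: Q_def)
    also have "(\<Sum>j\<in>roots. real (N j) * eval_rat (Q j) z) = (\<Sum>j\<in>roots. real (N j) * eval_rat (P j) z)"
      using \<open>0 \<notin> roots\<close> by (intro sum.cong) (auto simp: Q_def)
    also have "eval_rat w z = real K * eval_rat p0 z + eval_rat v z"
      unfolding w_def of_rat_poly_hom.hom_add poly_add eval_of_nat_mult ..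
    finally have "- (real (N 0) * eval_rat v z)
        = real (N 0 * K) * eval_rat p0 z + (\<Sum>j\<in>roots. real (N j) * eval_rat (P j) z)"
      by (simp add: algebra_simps)
    then show ?thesis
      unfolding of_rat_poly_hom.hom_add poly_add eval_of_nat_mult of_rat_poly_hom.hom_sum poly_sum
        of_rat_poly_hom.hom_uminus poly_minus by simp
  qed
  from this[OF square_in_roots] \<open>?r \<in> branch_polys\<close> have "of_nat (N 0) * - v \<in> branch_polys" by (simp add: branch_polys_def)
  with \<open>N 0 > 0\<close> show ?thesis by blast
qed

lemma uminus_in_branch_polys: "p \<in> branch_polys \<Longrightarrow> - p \<in> branch_polys"
proof -
  assume p: "p \<in> branch_polys"
  obtain m where m: "m > 0" "of_nat m * - p \<in> branch_polys" using negative_multiple_in_branch_polys by blast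
  then obtain n where "m = Suc n" by (cases m) auto
  then have "- p = of_nat m * - p + of_nat n * p" by (simp add: algebra_simps)
  with add_in_branch_polys[OF m(2) of_nat_mult_in_branch_polys[OF p, of n]] show ?thesis by simp
qed

lemma of_int_mult_in_branch_polys: "p \<in> branch_polys \<Longrightarrow> of_int k * p \<in> branch_polys"
  using of_nat_mult_in_branch_polys[of p "nat \<bar>k\<bar>"] uminus_in_branch_polys[of "of_nat (nat \<bar>k\<bar>) * p"]
  by (cases "k \<ge> 0") auto

lemma eval_of_int_mult: "eval_rat (of_int k * p) z = of_int k * eval_rat p z"
proof (cases "k \<ge> 0")
  case True
  then show ?thesis using eval_of_nat_mult[of "nat k" p z] by simp
next
  case False
  then show ?thesis
    using eval_of_nat_mult[of "nat (- k)" p z] by (simp add: of_rat_poly_hom.hom_uminus)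
qed

text \<open>
  It suffices to treat the finitely many powers of \<open>\<alpha>\<^sup>2\<close> that span \<open>\<int>[\<alpha>\<^sup>2]\<close>.
\<close>

lemma integral_multiples:
  assumes "algebraic_int (\<alpha>\<^sup>2)"
  shows "\<exists>m > 0. \<forall>q. real m * \<alpha> * eval_int q (\<alpha>\<^sup>2) \<in> branch_sums \<alpha>"
proof -
  obtain P where P: "eval_int P (\<alpha>\<^sup>2) = 0" "lead_coeff P = 1"
    using assms by (auto simp: algebraic_int_altdef_ipoly)
  let ?D = "degree P"
  have "\<exists>m > 0. of_nat m * monom 1 i \<in> branch_polys" for i
    using negative_multiple_in_branch_polys[of "- monom 1 i"] by simp
  then obtain M where M: "\<And>i. M i > 0" "\<And>i. of_nat (M i) * monom 1 i \<in> branch_polys" by metis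
  define m where "m = prod M {..<?D}"
  have "m > 0" using M(1) by (simp add: m_def prod_pos)
  have mon: "of_nat m * monom 1 i \<in> branch_polys" if "i < ?D" for i
  proof -
    have "m = prod M ({..<?D} - {i}) * M i"
      using that unfolding m_def by (subst prod.remove[of _ i]) auto
    then show ?thesis
      using of_nat_mult_in_branch_polys[OF M(2)[of i], of "prod M ({..<?D} - {i})"] by (simp add: mult.assoc)
  qed
  have "real m * \<alpha> * eval_int q (\<alpha>\<^sup>2) \<in> branch_sums \<alpha>" for q
  proof -
    obtain r where r: "eval_int q (\<alpha>\<^sup>2) = (\<Sum>i<?D. of_int (r i) * (\<alpha>\<^sup>2) ^ i)"
      using eval_int_reduce[OF P(2,1)] by blast
    let ?p = "\<Sum>i<?D. of_int (r i) * (of_nat m * monom 1 i)"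
    have "?p \<in> branch_polys" by (intro sum_in_branch_polys of_int_mult_in_branch_polys mon) simp
    moreover have "eval_rat ?p (\<alpha>\<^sup>2) = real m * eval_int q (\<alpha>\<^sup>2)"
      unfolding r of_rat_poly_hom.hom_sum poly_sum eval_of_int_mult eval_of_nat_mult
      by (simp add: map_poly_monom poly_monom sum_distrib_left ac_simps)
    ultimately show ?thesis by (simp add: branch_polys_def ac_simps)
  qed
  with \<open>m > 0\<close> show ?thesis by blast
qed

end

text \<open>
  The sequence \<open>y\<^sub>0 = 0\<close>, \<open>y\<^sub>1 = 1\<close>, \<open>y\<^sub>i\<^sub>+\<^sub>2 = \<alpha> y\<^sub>i\<^sub>+\<^sub>1 - y\<^sub>i\<close> of characteristic polynomials of paths, split by
  parity: \<open>y\<^sub>2\<^sub>n = \<alpha> even_path n\<close> and \<open>y\<^sub>2\<^sub>n\<^sub>+\<^sub>1 = odd_path n\<close>, as polynomials in \<open>\<alpha>\<^sup>2\<close>. Quotients of consecutive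
  terms form the orbit of \<open>\<infinity>\<close> under \<open>u \<mapsto> \<alpha> - 1 / u\<close>.
\<close>

fun even_path odd_path :: "nat \<Rightarrow> int poly" where
  "even_path 0 = 0"
| "odd_path 0 = 1"
| "even_path (Suc n) = odd_path n - even_path n"
| "odd_path (Suc n) = [:0, 1:] * (odd_path n - even_path n) - odd_path n"

lemma eval_paths_Suc:
  fixes z :: "'a :: field_char_0"
  shows "eval_int (even_path (Suc n)) z = eval_int (odd_path n) z - eval_int (even_path n) z"
    and "eval_int (odd_path (Suc n)) z = z * eval_int (even_path (Suc n)) z - eval_int (odd_path n) z"
  by (simp_all only: even_path.simps odd_path.simps of_int_poly_hom.hom_minus of_int_poly_hom.hom_mult
      poly_diff poly_mult) (simp add: of_int_hom.map_poly_pCons_hom)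

text \<open>
  The induction advances by two steps of the orbit, and \<open>\<alpha>\<close> not being a branch sum keeps the orbit
  away from 0.
\<close>

lemma path_in_branch_sums:
  assumes "\<alpha> \<noteq> 0" "\<alpha> \<notin> branch_sums \<alpha>"
  shows "eval_int (odd_path n) (\<alpha>\<^sup>2) \<noteq> 0 \<and>
    \<alpha> - \<alpha> * eval_int (even_path (Suc n)) (\<alpha>\<^sup>2) / eval_int (odd_path n) (\<alpha>\<^sup>2) \<in> branch_sums \<alpha>"
proof (induction n)
  case 0
  show ?case by (simp add: branch_sums.zero)
next
  case (Suc n)
  define a where "a = (\<lambda>n. eval_int (even_path n) (\<alpha>\<^sup>2))"
  define b where "b = (\<lambda>n. eval_int (odd_path n) (\<alpha>\<^sup>2))"
  have rec: "a (Suc i) = b i - a i" "b (Suc i) = \<alpha>\<^sup>2 * a (Suc i) - b i" for i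
    unfolding a_def b_def by (rule eval_paths_Suc)+
  let ?x = "\<alpha> - \<alpha> * a (Suc n) / b n"
  have x: "b n \<noteq> 0" "?x \<in> branch_sums \<alpha>" using Suc.IH by (simp_all add: a_def b_def)
  with assms(2) have "?x \<noteq> \<alpha>" by metis
  then have an: "a (Suc n) \<noteq> 0" by auto
  let ?y = "b n / (\<alpha> * a (Suc n))"
  have "1 / (\<alpha> - ?x) = ?y" by simp
  then have y: "?y \<in> branch_sums \<alpha>" using branch_sums_inverse[OF x(2) \<open>?x \<noteq> \<alpha>\<close>] by simp
  with assms(2) have "?y \<noteq> \<alpha>" by metis
  have diff: "\<alpha> - ?y = b (Suc n) / (\<alpha> * a (Suc n))"
    using an assms(1) unfolding rec(2) by (simp add: field_simps power2_eq_square)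
  with \<open>?y \<noteq> \<alpha>\<close> have bn: "b (Suc n) \<noteq> 0" by auto
  have "\<alpha> * a (Suc n) / b (Suc n) \<in> branch_sums \<alpha>"
    using branch_sums_inverse[OF y \<open>?y \<noteq> \<alpha>\<close>] unfolding diff by simp
  also have "\<alpha> * a (Suc n) / b (Suc n) = \<alpha> - \<alpha> * a (Suc (Suc n)) / b (Suc n)"
    using bn unfolding rec(1)[of "Suc n"] by (simp add: field_simps)
  finally show ?case using bn by (simp only: a_def b_def simp_thms)
qed

text \<open>
  The recursion is reversible and there are only finitely many residues modulo \<open>m\<close>, so the pairs of
  consecutive residues are purely periodic. The index \<open>k\<close> stands one step before the return to the
  initial values 0 and 1; there the recursion reads \<open>odd_path k = - 1\<close> modulo \<open>m\<close>.
\<close>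

lemma paths_periodic:
  fixes z :: "'a :: field_char_0"
  assumes "algebraic_int z" "m > 0"
  shows "\<exists>k a b. eval_int (even_path (Suc k)) z = of_nat m * eval_int a z \<and>
                 eval_int (odd_path k) z = of_nat m * eval_int b z - 1"
proof -
  obtain P where P: "eval_int P z = 0" "lead_coeff P = 1"
    using assms by (auto simp: algebraic_int_altdef_ipoly)
  let ?D = "degree P"
  define cong where "cong p q \<longleftrightarrow> (\<exists>e. eval_int p z - eval_int q z = of_nat m * eval_int e z)" for p q
  obtain r where r: "\<And>q. eval_int q z = (\<Sum>i<?D. of_int (r q i) * z ^ i)"
    using eval_int_reduce[OF P(2,1)] by metis
  define \<rho> where "\<rho> q = map (\<lambda>i. r q i mod int m) [0..<?D]" for q
  let ?R = "{xs. set xs \<subseteq> {0..<int m} \<and> length xs = ?D}"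
  have \<rho>_range: "\<rho> q \<in> ?R" for q using assms(2) by (auto simp: \<rho>_def)
  have congI: "cong p q" if "\<rho> p = \<rho> q" for p q
  proof -
    have "int m dvd r p i - r q i" if "i < ?D" for i
    proof -
      have "\<rho> p ! i = \<rho> q ! i" using \<open>\<rho> p = \<rho> q\<close> by simp
      then show ?thesis using that by (simp add: \<rho>_def mod_eq_dvd_iff)
    qed
    then have "\<forall>i. \<exists>e. i < ?D \<longrightarrow> r p i - r q i = int m * e" by (auto elim: dvdE)
    then obtain e where e: "\<And>i. i < ?D \<Longrightarrow> r p i - r q i = int m * e i" by metis
    have "eval_int p z - eval_int q z = (\<Sum>i<?D. of_int (r p i - r q i) * z ^ i)"
      unfolding r by (simp add: sum_subtractf left_diff_distrib)
    also have "\<dots> = of_nat m * eval_int (\<Sum>i<?D. monom (e i) i) z"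
      by (simp add: e of_int_poly_hom.hom_sum poly_sum map_poly_monom poly_monom sum_distrib_left mult.assoc)
    finally show ?thesis unfolding cong_def by blast
  qed
  define F where "F j = (\<rho> (even_path j), \<rho> (odd_path j))" for j
  have "finite (range F)"
    by (rule finite_subset[of _ "?R \<times> ?R"]) (use \<rho>_range in \<open>auto simp: F_def finite_lists_length_eq\<close>)
  then have "\<not> inj F" using finite_imageD infinite_UNIV_nat by blast
  then obtain i j where "F i = F j" "i < j" by (metis injI linorder_neqE_nat)
  then obtain k where k: "cong (even_path i) (even_path (i + Suc k))" "cong (odd_path i) (odd_path (i + Suc k))"
    using less_imp_Suc_add[of i j] by (auto simp: F_def intro!: congI simp del: even_path.simps odd_path.simps)
  have "cong (even_path 0) (even_path (Suc k)) \<and> cong (odd_path 0) (odd_path (Suc k))"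
    using k
  proof (induction i)
    case (Suc i)
    from Suc.prems obtain e d where
      e: "eval_int (even_path (Suc i)) z - eval_int (even_path (Suc (i + Suc k))) z = of_nat m * eval_int e z" and
      d: "eval_int (odd_path (Suc i)) z - eval_int (odd_path (Suc (i + Suc k))) z = of_nat m * eval_int d z"
      by (auto simp: cong_def simp del: even_path.simps odd_path.simps)
    have x: "eval_int ([:0, 1:] * e - d) z = z * eval_int e z - eval_int d z"
      by (simp only: of_int_poly_hom.hom_minus of_int_poly_hom.hom_mult poly_diff poly_mult)
        (simp add: of_int_hom.map_poly_pCons_hom)
    have odd: "eval_int (odd_path i) z - eval_int (odd_path (i + Suc k)) z = of_nat m * eval_int ([:0, 1:] * e - d) z"
    proof -
      have "eval_int (odd_path i) z - eval_int (odd_path (i + Suc k)) z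
        = z * (eval_int (even_path (Suc i)) z - eval_int (even_path (Suc (i + Suc k))) z)
          - (eval_int (odd_path (Suc i)) z - eval_int (odd_path (Suc (i + Suc k))) z)"
        unfolding eval_paths_Suc(2) by (simp only: algebra_simps)
      then show ?thesis unfolding e d x by (simp add: algebra_simps)
    qed
    have "eval_int (even_path i) z - eval_int (even_path (i + Suc k)) z
        = (eval_int (odd_path i) z - eval_int (odd_path (i + Suc k)) z)
          - (eval_int (even_path (Suc i)) z - eval_int (even_path (Suc (i + Suc k))) z)"
      unfolding eval_paths_Suc(1) by simp
    also have "\<dots> = of_nat m * eval_int ([:0, 1:] * e - d - e) z"
      unfolding e odd by (simp only: of_int_poly_hom.hom_minus poly_diff right_diff_distrib)
    finally have "cong (even_path i) (even_path (i + Suc k))" unfolding cong_def by blast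
    moreover have "cong (odd_path i) (odd_path (i + Suc k))" using odd unfolding cong_def by blast
    ultimately show ?case by (rule Suc.IH)
  qed simp
  then obtain e d where
    e: "- eval_int (even_path (Suc k)) z = of_nat m * eval_int e z" and
    d: "1 - eval_int (odd_path (Suc k)) z = of_nat m * eval_int d z"
    by (auto simp: cong_def simp del: even_path.simps(2) odd_path.simps(2))
  have "eval_int (even_path (Suc k)) z = of_nat m * eval_int (- e) z"
    by (simp add: of_int_poly_hom.hom_uminus flip: e del: even_path.simps odd_path.simps)
  moreover have "eval_int (odd_path k) z = of_nat m * eval_int (d - [:0, 1:] * e) z - 1"
  proof -
    have x: "eval_int (d - [:0, 1:] * e) z = eval_int d z - z * eval_int e z"
      by (simp only: of_int_poly_hom.hom_minus of_int_poly_hom.hom_mult poly_diff poly_mult)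
        (simp add: of_int_hom.map_poly_pCons_hom)
    have "eval_int (odd_path k) z = z * eval_int (even_path (Suc k)) z - eval_int (odd_path (Suc k)) z"
      unfolding eval_paths_Suc(2) by simp
    also have "\<dots> = - (z * (- eval_int (even_path (Suc k)) z)) + (1 - eval_int (odd_path (Suc k)) z) - 1"
      by simp
    finally show ?thesis unfolding e d x by (simp add: algebra_simps)
  qed
  ultimately show ?thesis by blast
qed

context missing_tree_eigenvalue
begin

text \<open>
  The orbit point \<open>u = \<alpha> m a / (m b - 1)\<close> satisfies \<open>\<alpha> - u \<in> branch_sums \<alpha>\<close>, and \<open>N u\<close> lies in
  \<open>m \<alpha> \<int>[\<alpha>\<^sup>2]\<close> for the norm \<open>N\<close> of \<open>1 - m b\<close>. Hence \<open>N \<alpha>\<close> and \<open>m \<alpha>\<close> are branch sums with \<open>N\<close> congruent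
  to 1 modulo \<open>m\<close>.
\<close>

lemma not_algebraic_int: "\<not> algebraic_int (\<alpha>\<^sup>2)"
proof
  assume int: "algebraic_int (\<alpha>\<^sup>2)"
  define \<theta> where "\<theta> = \<alpha>\<^sup>2"
  obtain m where m: "m > 0" "\<And>q. real m * \<alpha> * eval_int q \<theta> \<in> branch_sums \<alpha>"
    using integral_multiples[OF int] unfolding \<theta>_def by blast
  obtain k a b where ab: "eval_int (even_path (Suc k)) \<theta> = real m * eval_int a \<theta>"
      "eval_int (odd_path k) \<theta> = real m * eval_int b \<theta> - 1"
    using paths_periodic[OF int m(1)] unfolding \<theta>_def by blast
  let ?B = "real m * eval_int b \<theta> - 1"
  have B: "?B \<noteq> 0" "\<alpha> - \<alpha> * (real m * eval_int a \<theta>) / ?B \<in> branch_sums \<alpha>"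
    using path_in_branch_sums[OF \<alpha>_nonzero missing, of k] unfolding \<theta>_def[symmetric] ab by auto
  have "algebraic_int (eval_int b \<theta>)" using algebraic_int_eval_int[OF int] by (simp add: \<theta>_def)
  then obtain X where X: "eval_int X (eval_int b \<theta>) = 0" "lead_coeff X = 1"
    by (auto simp: algebraic_int_altdef_ipoly)
  obtain E N where EN: "of_int N = (1 - real m * eval_int b \<theta>) * eval_int E (eval_int b \<theta>)"
      "int m dvd N - 1"
    using int_multiple_of_one_minus[of X "degree X" "int m" "eval_int b \<theta>"] X by auto
  have comp: "eval_int E (eval_int b \<theta>) = eval_int (pcompose E b) \<theta>"
    by (simp add: of_int_hom.map_poly_pcompose poly_pcompose)
  have N: "of_int N / ?B = - eval_int (pcompose E b) \<theta>"
    using B(1) unfolding EN(1) comp by (simp add: divide_eq_eq algebra_simps)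
  \<comment> \<open>The factor \<open>N\<^sup>2\<close> in place of \<open>N\<close> is a natural number and still congruent to 1 modulo \<open>m\<close>.\<close>
  let ?c = "of_int N * a * pcompose E b"
  have "real (nat (N\<^sup>2)) * (\<alpha> - \<alpha> * (real m * eval_int a \<theta>) / ?B) \<in> branch_sums \<alpha>"
    using B(2) by (rule branch_sums_of_nat_mult)
  moreover have "real (nat (N\<^sup>2)) * (\<alpha> - \<alpha> * (real m * eval_int a \<theta>) / ?B)
      = of_int (N\<^sup>2) * \<alpha> + real m * \<alpha> * eval_int ?c \<theta>"
  proof -
    have "real (nat (N\<^sup>2)) * (\<alpha> - \<alpha> * (real m * eval_int a \<theta>) / ?B)
        = of_int (N\<^sup>2) * \<alpha> - real m * \<alpha> * (of_int N * eval_int a \<theta> * (of_int N / ?B))"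
      by (simp add: power2_eq_square algebra_simps)
    also have "\<dots> = of_int (N\<^sup>2) * \<alpha> + real m * \<alpha> * eval_int ?c \<theta>"
      unfolding N by (simp add: of_int_poly_hom.hom_mult of_int_poly of_int_hom.map_poly_hom_smult)
    finally show ?thesis .
  qed
  ultimately have 1: "of_int (N\<^sup>2) * \<alpha> + real m * \<alpha> * eval_int ?c \<theta> \<in> branch_sums \<alpha>" by simp
  from EN(2) have "int m dvd (N - 1) * (N + 1)" by simp
  then have "int m dvd N\<^sup>2 - 1" by (simp add: power2_eq_square algebra_simps)
  then obtain t where t: "N\<^sup>2 = 1 + int m * t" by (metis dvdE add.commute diff_add_cancel)
  have "real m * \<alpha> * eval_int (- ?c - [:t:]) \<theta> \<in> branch_sums \<alpha>" by (rule m(2))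
  from branch_sums_add[OF 1 this] have "\<alpha> \<in> branch_sums \<alpha>"
    unfolding t of_int_poly_hom.hom_minus of_int_poly_hom.hom_uminus poly_diff poly_minus
    by (simp add: of_int_hom.map_poly_pCons_hom algebra_simps)
  with missing show False ..
qed

end

theorem totally_real_in_branch_sums:
  fixes \<alpha> :: real
  assumes "algebraic_int (\<alpha>\<^sup>2)" "irreducible f" "eval_rat f (\<alpha>\<^sup>2) = 0"
    and "\<And>z :: complex. eval_rat f z = 0 \<Longrightarrow> \<exists>x > 0. z = of_real x"
  shows "\<alpha> \<in> branch_sums \<alpha>"
proof (rule ccontr)
  assume "\<alpha> \<notin> branch_sums \<alpha>"
  moreover from this have "\<alpha> \<noteq> 0" using branch_sums.zero by metis
  ultimately interpret missing_tree_eigenvalue \<alpha> f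
    using assms by unfold_locales
  show False using not_algebraic_int assms(1) by blast
qed

section \<open>Trees given by parent functions\<close>

text \<open>
  Numbering the vertices so that each one comes after its parent lets trees be joined by shifting
  the numbers of the second tree. The vertex 0 is the root.
\<close>

definition parent_graph :: "nat \<Rightarrow> (nat \<Rightarrow> nat) \<Rightarrow> nat pair_pre_digraph" where
  "parent_graph n p =
     \<lparr>pverts = {..<n}, parcs = {(v, w). 0 < v \<and> v < n \<and> w = p v \<or> 0 < w \<and> w < n \<and> v = p w}\<rparr>"

lemma pcas_pawalk_verts: "pcas u es v \<Longrightarrow> pawalk_verts u es = u # map snd es"
  by (induction es arbitrary: u) auto

lemma pcas_nth_Suc: "pcas u es v \<Longrightarrow> Suc i < length es \<Longrightarrow> fst (es ! Suc i) = snd (es ! i)"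
proof (induction es arbitrary: u i)
  case (Cons e es)
  show ?case
  proof (cases i)
    case 0
    with Cons.prems obtain e' es' where "es = e' # es'" by (cases es) auto
    with Cons.prems 0 show ?thesis by simp
  next
    case (Suc k)
    then show ?thesis using Cons.prems Cons.IH[of "snd e" k] by simp
  qed
qed simp

lemma pcas_last: "pcas u es v \<Longrightarrow> es \<noteq> [] \<Longrightarrow> snd (es ! (length es - 1)) = v"
proof (induction es arbitrary: u)
  case (Cons e es)
  then show ?case by (cases es) auto
qed simp

lemma parcs_parent_graph_less:
  assumes "\<And>v. 0 < v \<Longrightarrow> v < n \<Longrightarrow> p v < v"
    and "(v, w) \<in> parcs (parent_graph n p) \<or> (w, v) \<in> parcs (parent_graph n p)" "w \<le> v"
  shows "0 < v \<and> v < n \<and> w = p v"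
  using assms(2,3) assms(1)[of w] assms(1)[of v] unfolding parent_graph_def by fastforce

text \<open>
  On a cycle of length at least 3, the largest vertex has two distinct neighbours. Both are smaller,
  but the only smaller neighbour of a vertex is its parent.
\<close>

lemma parent_graph_no_cycle:
  assumes p: "\<And>v. 0 < v \<Longrightarrow> v < n \<Longrightarrow> p v < v"
    and es: "set es \<subseteq> parcs (parent_graph n p)" "pcas u es u" "distinct (map snd es)"
  shows "length es < 3"
proof (rule ccontr)
  let ?k = "length es"
  assume "\<not> ?k < 3"
  then have k: "?k \<ge> 3" by simp
  define y where "y i = snd (es ! i)" for i
  have "Max (y ` {..<?k}) \<in> y ` {..<?k}" using k by (intro Max_in) (auto simp: lessThan_empty_iff)
  then obtain m where m: "m < ?k" "Max (y ` {..<?k}) = y m" by auto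
  have max: "y i \<le> y m" if "i < ?k" for i
    using that m(2)[symmetric] by (auto intro: Max_ge)
  \<comment> \<open>The cyclic predecessor and successor of \<open>m\<close>.\<close>
  define i where "i = (if m = 0 then ?k - 1 else m - 1)"
  define j where "j = (if m = ?k - 1 then 0 else Suc m)"
  have fst0: "fst (es ! 0) = u" using es(2) k by (cases es) auto
  have lst: "y (?k - 1) = u" using pcas_last[OF es(2)] k by (force simp: y_def)
  have arc: "es ! l \<in> parcs (parent_graph n p)" if "l < ?k" for l
    using that es(1) by (meson nth_mem subsetD)
  have i: "i < ?k" "fst (es ! m) = y i"
    using m(1) k fst0 lst pcas_nth_Suc[OF es(2), of "m - 1"] by (auto simp: i_def y_def)
  have j: "j < ?k" "fst (es ! j) = y m"
    using m(1) k fst0 lst pcas_nth_Suc[OF es(2), of m] by (auto simp: j_def y_def)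
  have "(y i, y m) \<in> parcs (parent_graph n p)"
    using arc[OF m(1)] i(2) by (metis prod.collapse y_def)
  then have "y i = p (y m)" using parcs_parent_graph_less[OF p, where v = "y m" and w = "y i"] max[OF i(1)] by blast
  moreover have "(y m, y j) \<in> parcs (parent_graph n p)"
    using arc[OF j(1)] j(2) by (metis prod.collapse y_def)
  then have "y j = p (y m)" using parcs_parent_graph_less[OF p, where v = "y m" and w = "y j"] max[OF j(1)] by blast
  ultimately have "map snd es ! i = map snd es ! j" using i(1) j(1) by (simp add: y_def)
  then have "i = j" using nth_eq_iff_index_eq[OF es(3), of i j] i(1) j(1) by simp
  then show False using k m(1) by (auto simp: i_def j_def split: if_splits)
qed

lemma finite_tree_parent_graph:
  assumes "n > 0" and p: "\<And>v. 0 < v \<Longrightarrow> v < n \<Longrightarrow> p v < v"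
  shows "finite_tree (parent_graph n p)"
proof -
  let ?G = "parent_graph n p"
  have verts: "pverts ?G = {..<n}" by (simp add: parent_graph_def)
  have arcs: "(v, w) \<in> parcs ?G \<Longrightarrow> v < n \<and> w < n \<and> v \<noteq> w" for v w
    using p[of v] p[of w] by (auto simp: parent_graph_def)
  have symm: "(v, w) \<in> parcs ?G \<Longrightarrow> (w, v) \<in> parcs ?G" for v w
    by (auto simp: parent_graph_def)
  have "parcs ?G \<subseteq> {..<n} \<times> {..<n}" using arcs by auto
  then have fin: "finite (parcs ?G)" by (rule finite_subset) simp
  interpret pair_graph ?G
    by unfold_locales (use arcs symm fin in \<open>auto simp: verts symmetric_def sym_def\<close>)
  have to_root: "v \<rightarrow>\<^sup>*\<^bsub>with_proj ?G\<^esub> 0" if "v < n" for v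
    using that
  proof (induction v rule: less_induct)
    case (less v)
    show ?case
    proof (cases "v = 0")
      case True
      then show ?thesis using less.prems by (simp add: verts)
    next
      case False
      then have "p v < v" using p less.prems by simp
      then have "p v \<rightarrow>\<^sup>*\<^bsub>with_proj ?G\<^esub> 0" using less by simp
      moreover have "(v, p v) \<in> parcs ?G" using False less.prems by (simp add: parent_graph_def)
      ultimately show ?thesis by (metis adj_reachable_trans with_proj_simps(3))
    qed
  qed
  have "strongly_connected (with_proj ?G)"
    unfolding strongly_connected_def
  proof (intro conjI ballI)
    show "verts (with_proj ?G) \<noteq> {}" using assms(1) by (auto simp: verts)
    fix u v assume "u \<in> verts (with_proj ?G)" "v \<in> verts (with_proj ?G)"
    then have "u \<rightarrow>\<^sup>*\<^bsub>with_proj ?G\<^esub> 0" "0 \<rightarrow>\<^sup>*\<^bsub>with_proj ?G\<^esub> v"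
      using to_root symmetric_reachable' by (auto simp: verts)
    then show "u \<rightarrow>\<^sup>*\<^bsub>with_proj ?G\<^esub> v" by (rule reachable_trans)
  qed
  then have "Digraph_Component.connected (with_proj ?G)"
    unfolding connected_def strongly_connected_def
    by (simp add: reachable_mk_symmetric_eq[OF sym_arcs])
  moreover have "\<not> (\<exists>es. pre_digraph.cycle (with_proj ?G) es \<and> 3 \<le> length es)"
  proof
    assume "\<exists>es. pre_digraph.cycle (with_proj ?G) es \<and> 3 \<le> length es"
    then obtain es u where "awalk u es u" "distinct (tl (pawalk_verts u es))" "3 \<le> length es"
      by (auto simp: cycle_def)
    moreover from this have "pcas u es u" "set es \<subseteq> parcs ?G" by (auto simp: awalk_def)
    ultimately show False using parent_graph_no_cycle[OF p, where es = es and u = u] by (auto simp: pcas_pawalk_verts)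
  qed
  ultimately show ?thesis
    unfolding finite_tree_def using pair_graph_axioms by blast
qed

definition adj_sum :: "nat \<Rightarrow> (nat \<Rightarrow> nat) \<Rightarrow> (nat \<Rightarrow> 'a :: comm_ring_1) \<Rightarrow> nat \<Rightarrow> 'a" where
  "adj_sum n p x v = (if v = 0 then 0 else x (p v)) + sum x {w. 0 < w \<and> w < n \<and> p w = v}"

lemma sum_neighbours_parent_graph:
  assumes "\<And>v. 0 < v \<Longrightarrow> v < n \<Longrightarrow> p v < v" "v < n"
  shows "sum x {w. w < n \<and> (w, v) \<in> parcs (parent_graph n p)} = adj_sum n p x v"
proof -
  let ?C = "{w. 0 < w \<and> w < n \<and> p w = v}"
  have "{w. w < n \<and> (w, v) \<in> parcs (parent_graph n p)} = (if v = 0 then {} else {p v}) \<union> ?C"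
    using assms(2) assms(1)[of v] by (auto simp: parent_graph_def)
  moreover have "(if v = 0 then {} else {p v}) \<inter> ?C = {}"
    using assms(1)[of "p v"] assms(1)[of v] assms(2) by auto
  ultimately show ?thesis by (simp add: adj_sum_def sum.union_disjoint)
qed

text \<open>
  Each inference that produces a branch sum is matched by joining the roots of two trees, where the
  vector on the second tree is rescaled to fit the eigenvalue equation at its root. The colouring \<open>c\<close>
  records the bipartition.
\<close>

lemma branch_sum_realised:
  assumes "s \<in> branch_sums \<alpha>"
  shows "\<exists>n p x. \<exists>c :: nat \<Rightarrow> bool. n > 0 \<and> (\<forall>v. 0 < v \<and> v < n \<longrightarrow> p v < v \<and> c v \<noteq> c (p v)) \<and> x 0 = 1 \<and>
    adj_sum n p x 0 = s \<and> (\<forall>v. 0 < v \<and> v < n \<longrightarrow> adj_sum n p x v = \<alpha> * x v)"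
  using assms
proof induction
  case zero
  show ?case
    by (intro exI[of _ "1 :: nat"] exI[of _ "\<lambda>_. 0 :: nat"] exI[of _ "\<lambda>_. 1 :: real"]
        exI[of _ "\<lambda>_. True"]) (auto simp: adj_sum_def)
next
  case (graft s t)
  from graft.IH(1) obtain n1 p1 x1 and c1 :: "nat \<Rightarrow> bool" where
    1: "n1 > 0" "\<And>v. 0 < v \<Longrightarrow> v < n1 \<Longrightarrow> p1 v < v" "\<And>v. 0 < v \<Longrightarrow> v < n1 \<Longrightarrow> c1 v \<noteq> c1 (p1 v)" "x1 0 = 1"
      "adj_sum n1 p1 x1 0 = s" "\<And>v. 0 < v \<Longrightarrow> v < n1 \<Longrightarrow> adj_sum n1 p1 x1 v = \<alpha> * x1 v" by blast
  from graft.IH(2) obtain n2 p2 x2 and c2 :: "nat \<Rightarrow> bool" where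
    2: "n2 > 0" "\<And>v. 0 < v \<Longrightarrow> v < n2 \<Longrightarrow> p2 v < v" "\<And>v. 0 < v \<Longrightarrow> v < n2 \<Longrightarrow> c2 v \<noteq> c2 (p2 v)" "x2 0 = 1"
      "adj_sum n2 p2 x2 0 = t" "\<And>v. 0 < v \<Longrightarrow> v < n2 \<Longrightarrow> adj_sum n2 p2 x2 v = \<alpha> * x2 v" by blast
  define \<tau> where "\<tau> = 1 / (\<alpha> - t)"
  define n where "n = n1 + n2"
  define p where "p v = (if v < n1 then p1 v else if v = n1 then 0 else n1 + p2 (v - n1))" for v
  define x where "x v = (if v < n1 then x1 v else \<tau> * x2 (v - n1))" for v
  \<comment> \<open>The colours of the second tree are swapped if its root has the colour of the first root.\<close>
  define c where "c v = (if v < n1 then c1 v else (c2 (v - n1) = (c2 0 \<noteq> c1 0)))" for v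
  have p_less: "p v < v" if "0 < v" "v < n" for v
  proof (cases "v \<le> n1")
    case True
    then show ?thesis using that(1) 1(1) 1(2)[of v] by (auto simp: p_def)
  next
    case False
    then have "p2 (v - n1) < v - n1" using 2(2)[of "v - n1"] that(2) by (auto simp: n_def)
    then show ?thesis using False by (simp add: p_def)
  qed
  have c_neq: "c v \<noteq> c (p v)" if "0 < v" "v < n" for v
  proof (cases "v < n1")
    case True
    then show ?thesis using 1(2,3)[of v] that by (auto simp: p_def c_def)
  next
    case False
    show ?thesis
    proof (cases "v = n1")
      case True
      then show ?thesis using 1(1) by (auto simp: p_def c_def)
    next
      case neq: False
      with False that have "0 < v - n1" "v - n1 < n2" by (auto simp: n_def)
      from 2(3)[OF this] show ?thesis using False neq by (auto simp: p_def c_def)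
    qed
  qed
  have old: "adj_sum n p x v = adj_sum n1 p1 x1 v + (if v = 0 then \<tau> else 0)" if v: "v < n1" for v
  proof -
    let ?C = "{w. 0 < w \<and> w < n1 \<and> p1 w = v}"
    have "{w. 0 < w \<and> w < n \<and> p w = v} = ?C \<union> (if v = 0 then {n1} else {})"
      using v 1(1) 2(1) by (auto simp: p_def n_def)
    moreover have "sum x (?C \<union> (if v = 0 then {n1} else {})) = sum x ?C + (if v = 0 then x n1 else 0)"
      by (subst sum.union_disjoint) auto
    moreover have "sum x ?C = sum x1 ?C" by (intro sum.cong) (auto simp: x_def)
    moreover have "x n1 = \<tau>" using 2(4) by (simp add: x_def)
    moreover have "v \<noteq> 0 \<Longrightarrow> x (p v) = x1 (p1 v)" using v 1(2)[of v] by (simp add: x_def p_def)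
    ultimately show ?thesis by (auto simp: adj_sum_def)
  qed
  have new: "adj_sum n p x (n1 + v) = \<tau> * adj_sum n2 p2 x2 v + (if v = 0 then 1 else 0)" if v: "v < n2" for v
  proof -
    let ?C = "{w. 0 < w \<and> w < n2 \<and> p2 w = v}"
    have "{w. 0 < w \<and> w < n \<and> p w = n1 + v} = (+) n1 ` ?C"
    proof (intro equalityI subsetI)
      fix w assume w: "w \<in> {w. 0 < w \<and> w < n \<and> p w = n1 + v}"
      then have "w > n1" using 1(1) 1(2)[of w] by (auto simp: p_def split: if_splits)
      with w show "w \<in> (+) n1 ` ?C"
        by (intro image_eqI[of _ _ "w - n1"]) (auto simp: p_def n_def)
    qed (auto simp: p_def n_def)
    moreover have "sum x ((+) n1 ` ?C) = \<tau> * sum x2 ?C"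
      by (subst sum.reindex) (auto simp: x_def sum_distrib_left)
    moreover have "x (p (n1 + v)) = (if v = 0 then 1 else \<tau> * x2 (p2 v))"
      using 1(1,4) by (simp add: p_def x_def)
    ultimately show ?thesis using 1(1) by (simp add: adj_sum_def distrib_left)
  qed
  have "adj_sum n p x v = \<alpha> * x v" if v: "0 < v" "v < n" for v
  proof (cases "v < n1")
    case True
    then show ?thesis using old[of v] 1(6) v by (simp add: x_def)
  next
    case False
    then obtain w where w: "v = n1 + w" "w < n2" using v by (metis add_less_cancel_left le_Suc_ex n_def not_le)
    show ?thesis
    proof (cases "w = 0")
      case True
      have "\<tau> * t + 1 = \<alpha> * \<tau>" using graft.hyps(3) by (simp add: \<tau>_def field_simps)
      then show ?thesis using new[OF w(2)] True 2(4,5) w by (simp add: x_def)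
    next
      case False
      then show ?thesis using new[OF w(2)] 2(6)[of w] w by (simp add: x_def)
    qed
  qed
  moreover have "adj_sum n p x 0 = s + 1 / (\<alpha> - t)" using old[of 0] 1(1,5) by (simp add: \<tau>_def)
  moreover have "x 0 = 1" "n > 0" using 1(1,4) by (auto simp: x_def n_def)
  ultimately show ?case using p_less c_neq by blast
qed

section \<open>Spectra of Coxeter transformations\<close>

text \<open>
  The reflections in the pairwise non-adjacent vertices \<open>V\<close>, applied to a coordinate function over an
  arbitrary ring: the same formula serves for the real map, its complexification and its integral
  matrix.
\<close>

definition flip_on :: "(nat \<Rightarrow> nat set) \<Rightarrow> nat set \<Rightarrow> (nat \<Rightarrow> 'a :: comm_ring_1) \<Rightarrow> nat \<Rightarrow> 'a" where
  "flip_on nbrs V x i = (if i \<in> V then sum x (nbrs i) - x i else x i)"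

lemma flip_on_cong:
  assumes "\<And>j. j \<in> insert i (nbrs i) \<Longrightarrow> x j = y j"
  shows "flip_on nbrs V x i = flip_on nbrs V y i"
proof -
  have "sum x (nbrs i) = sum y (nbrs i)" using assms by (intro sum.cong) auto
  then show ?thesis using assms[of i] by (simp add: flip_on_def)
qed

lemma flip_on_linear:
  "flip_on nbrs V (\<lambda>i. \<Sum>j\<in>J. a j i * y j) i = (\<Sum>j\<in>J. flip_on nbrs V (a j) i * y j)"
proof -
  have "(\<Sum>w\<in>nbrs i. \<Sum>j\<in>J. a j w * y j) = (\<Sum>j\<in>J. \<Sum>w\<in>nbrs i. a j w * y j)" by (rule sum.swap)
  then show ?thesis by (simp add: flip_on_def sum_distrib_right left_diff_distrib sum_subtractf)
qed

lemma flip_on_of_int: "flip_on nbrs V (\<lambda>i. of_int (x i)) i = of_int (flip_on nbrs V x i)"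
  by (simp add: flip_on_def)

locale bipartite_graph_on =
  fixes n :: nat and G :: "nat pair_pre_digraph" and V0 V1 :: "nat set"
  assumes graph: "pair_graph G" and verts: "pverts G = {..<n}" and bip: "bipartition G V0 V1"
begin

definition nbrs :: "nat \<Rightarrow> nat set" where "nbrs v = {w. w < n \<and> (w, v) \<in> parcs G}"

lemma sym_arc: "(v, w) \<in> parcs G \<Longrightarrow> (w, v) \<in> parcs G"
proof -
  interpret pair_graph G by (rule graph)
  show "(v, w) \<in> parcs G \<Longrightarrow> (w, v) \<in> parcs G"
    using pair_sym_arcs by (auto simp: symmetric_def dest: symD)
qed

lemma arc_bound: "(v, w) \<in> parcs G \<Longrightarrow> v < n \<and> w < n \<and> v \<noteq> w"
proof -
  interpret pair_graph G by (rule graph)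
  show "(v, w) \<in> parcs G \<Longrightarrow> v < n \<and> w < n \<and> v \<noteq> w"
    using in_arcsD1 in_arcsD2 pair_no_loops verts by fastforce
qed

lemma sides: "V0 \<union> V1 = {..<n}" "V0 \<inter> V1 = {}"
  using bip verts by (auto simp: bipartition_def)

lemma nbrs_sides: "v \<in> V0 \<Longrightarrow> nbrs v \<subseteq> V1" "v \<in> V1 \<Longrightarrow> nbrs v \<subseteq> V0"
  using bip sides(2) by (auto simp: nbrs_def bipartition_def)

lemma finite_sides: "finite V0" "finite V1"
  using sides(1) by (metis finite_Un finite_lessThan)+

lemma coxeter_reflection_eq:
  assumes "v < n"
  shows "coxeter_reflection G v (vec n x) = vec n (\<lambda>i. if i = v then sum x (nbrs v) - x v else x i)"
proof -
  have card: "card (pverts G) = n" by (simp add: verts)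
  have "coxeter_gram G *\<^sub>v unit_vec n v = vec n (\<lambda>i. coxeter_gram G $$ (i, v))"
    using assms by (intro eq_vecI) (auto simp: coxeter_gram_def card row_def)
  then have "coxeter_form G (vec n x) (unit_vec n v)
      = (\<Sum>i<n. x i * (if i = v then 1 else if (i, v) \<in> parcs G then - 1 / 2 else 0))"
    using assms by (simp add: coxeter_form_def scalar_prod_def coxeter_gram_def card atLeast0LessThan)
  also have "\<dots> = (\<Sum>i<n. (if i = v then x i else 0) + (if (i, v) \<in> parcs G then - x i / 2 else 0))"
    using arc_bound by (intro sum.cong) auto
  also have "\<dots> = x v + (\<Sum>i\<in>nbrs v. - x i / 2)"
    using assms by (simp add: sum.distrib nbrs_def sum.If_cases Int_def lessThan_def)
  also have "\<dots> = x v - sum x (nbrs v) / 2" by (simp add: sum_negf sum_divide_distrib)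
  finally show ?thesis
    using assms by (intro eq_vecI) (auto simp: coxeter_reflection_def Let_def card)
qed

lemma foldr_coxeter_reflection:
  assumes "distinct vs" "set vs \<subseteq> {..<n}" "\<And>v. v \<in> set vs \<Longrightarrow> nbrs v \<inter> set vs = {}"
  shows "foldr (coxeter_reflection G) vs (vec n x) = vec n (flip_on nbrs (set vs) x)"
  using assms
proof (induction vs)
  case Nil
  then show ?case by (simp add: flip_on_def)
next
  case (Cons v vs)
  have "foldr (coxeter_reflection G) vs (vec n x) = vec n (flip_on nbrs (set vs) x)"
    using Cons.prems(1,2) Cons.prems(3) by (intro Cons.IH) auto
  moreover have "sum (flip_on nbrs (set vs) x) (nbrs v) = sum x (nbrs v)"
    using Cons.prems(3)[of v] by (intro sum.cong) (auto simp: flip_on_def)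
  moreover have "flip_on nbrs (set vs) x v = x v" using Cons.prems(1) by (simp add: flip_on_def)
  ultimately show ?case
    using Cons.prems(1,2) by (auto simp: coxeter_reflection_eq flip_on_def intro!: eq_vecI)
qed

lemma coxeter_transformation_eq:
  "coxeter_transformation G V0 V1 (vec n x) = vec n (flip_on nbrs V0 (flip_on nbrs V1 x))"
proof -
  have *: "foldr (coxeter_reflection G) (sorted_list_of_set V) (vec n x) = vec n (flip_on nbrs V x)"
    if "V = V0 \<or> V = V1" for V x
  proof -
    have "finite V" using that finite_sides by auto
    moreover have "V \<subseteq> {..<n}" using that sides by auto
    moreover have "nbrs v \<inter> V = {}" if "v \<in> V" for v
      using that \<open>V = V0 \<or> V = V1\<close> nbrs_sides sides(2) by blast
    ultimately show ?thesis using foldr_coxeter_reflection[of "sorted_list_of_set V" x] by simp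
  qed
  show ?thesis by (simp add: coxeter_transformation_def *)
qed

definition coxeter_int_matrix :: "int mat" where
  "coxeter_int_matrix = mat n n (\<lambda>(i, j). flip_on nbrs V0 (flip_on nbrs V1 (\<lambda>i. of_bool (i = j))) i)"

lemma map_mat_matrix_of_coxeter:
  "map_mat complex_of_real (matrix_of n (coxeter_transformation G V0 V1)) = map_mat of_int coxeter_int_matrix"
proof (rule eq_matI)
  fix i j assume "i < dim_row (map_mat of_int coxeter_int_matrix)" "j < dim_col (map_mat of_int coxeter_int_matrix)"
  then have ij: "i < n" "j < n" by (auto simp: coxeter_int_matrix_def)
  have "unit_vec n j = vec n (\<lambda>i. real_of_int (of_bool (i = j)))"
    by (intro eq_vecI) (use ij in auto)
  then have "coxeter_transformation G V0 V1 (unit_vec n j) $ i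
      = flip_on nbrs V0 (flip_on nbrs V1 (\<lambda>i. real_of_int (of_bool (i = j)))) i"
    using ij by (simp only: coxeter_transformation_eq index_vec)
  also have "\<dots> = real_of_int (flip_on nbrs V0 (flip_on nbrs V1 (\<lambda>i. of_bool (i = j))) i)"
    unfolding flip_on_of_int ..
  finally show "map_mat complex_of_real (matrix_of n (coxeter_transformation G V0 V1)) $$ (i, j)
      = map_mat of_int coxeter_int_matrix $$ (i, j)"
    using ij by (simp add: matrix_of_def coxeter_int_matrix_def mat_of_cols_def)
qed (auto simp: matrix_of_def coxeter_int_matrix_def mat_of_cols_def)

lemma coxeter_eigenvalue_iff_root:
  "eigenvalue (map_mat complex_of_real (matrix_of n (coxeter_transformation G V0 V1))) z \<longleftrightarrow>
   eval_int (char_poly coxeter_int_matrix) z = 0"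
proof -
  have C: "coxeter_int_matrix \<in> carrier_mat n n" by (simp add: coxeter_int_matrix_def)
  then have "map_mat of_int coxeter_int_matrix \<in> carrier_mat n n" by simp
  from eigenvalue_root_char_poly[OF this, of z] show ?thesis
    unfolding map_mat_matrix_of_coxeter of_int_hom.char_poly_hom[OF C] .
qed

lemma coxeter_int_matrix_mult:
  fixes y :: "nat \<Rightarrow> complex"
  shows "map_mat of_int coxeter_int_matrix *\<^sub>v vec n y = vec n (flip_on nbrs V0 (flip_on nbrs V1 y))"
proof (rule eq_vecI)
  fix i assume "i < dim_vec (vec n (flip_on nbrs V0 (flip_on nbrs V1 y)))"
  then have i: "i < n" by simp
  have "(map_mat of_int coxeter_int_matrix *\<^sub>v vec n y) $ i
      = (\<Sum>j<n. of_int (flip_on nbrs V0 (flip_on nbrs V1 (\<lambda>i. of_bool (i = j))) i) * y j)"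
    using i by (simp add: coxeter_int_matrix_def scalar_prod_def atLeast0LessThan)
  also have "\<dots> = (\<Sum>j<n. flip_on nbrs V0 (flip_on nbrs V1 (\<lambda>i. of_int (of_bool (i = j)))) i * y j)"
    unfolding flip_on_of_int ..
  also have "\<dots> = flip_on nbrs V0 (flip_on nbrs V1 (\<lambda>i. \<Sum>j<n. of_int (of_bool (i = j)) * y j)) i"
    unfolding flip_on_linear ..
  also have "\<dots> = flip_on nbrs V0 (flip_on nbrs V1 y) i"
  proof (intro flip_on_cong)
    fix k l assume "k \<in> insert i (nbrs i)" "l \<in> insert k (nbrs k)"
    then have "l < n" using i by (auto simp: nbrs_def)
    then show "(\<Sum>j<n. of_int (of_bool (l = j)) * y j) = y l"
      by (subst sum.remove[of _ l]) auto
  qed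
  finally show "(map_mat of_int coxeter_int_matrix *\<^sub>v vec n y) $ i = vec n (flip_on nbrs V0 (flip_on nbrs V1 y)) $ i"
    using i by simp
qed (simp add: coxeter_int_matrix_def)

text \<open>
  In the coordinates on \<open>V0\<close> the transformation uses the coordinates on \<open>V1\<close> after the first flip, which
  for an eigenvector are \<open>z\<close> times the original ones.
\<close>

lemma coxeter_eigenvalue_iff:
  "eigenvalue (map_mat complex_of_real (matrix_of n (coxeter_transformation G V0 V1))) z \<longleftrightarrow>
   (\<exists>y. (\<exists>i<n. y i \<noteq> 0) \<and> (\<forall>v\<in>V1. sum y (nbrs v) = (1 + z) * y v) \<and>
        (\<forall>v\<in>V0. z * sum y (nbrs v) = (1 + z) * y v))" (is "?L \<longleftrightarrow> (\<exists>y. ?E y)")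
proof -
  have step: "(\<forall>i<n. flip_on nbrs V0 (flip_on nbrs V1 y) i = z * y i) \<longleftrightarrow>
      (\<forall>v\<in>V1. sum y (nbrs v) = (1 + z) * y v) \<and> (\<forall>v\<in>V0. z * sum y (nbrs v) = (1 + z) * y v)" for y :: "nat \<Rightarrow> complex"
  proof -
    have 1: "flip_on nbrs V0 (flip_on nbrs V1 y) v = sum y (nbrs v) - y v" if "v \<in> V1" for v
      using that sides(2) by (auto simp: flip_on_def)
    have 0: "flip_on nbrs V0 (flip_on nbrs V1 y) v = z * sum y (nbrs v) - y v"
      if "v \<in> V0" "\<forall>v\<in>V1. sum y (nbrs v) = (1 + z) * y v" for v
    proof -
      have "flip_on nbrs V1 y w = z * y w" if "w \<in> nbrs v" for w
      proof -
        have "w \<in> V1" using that \<open>v \<in> V0\<close> nbrs_sides by blast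
        then show ?thesis using \<open>\<forall>v\<in>V1. _\<close> by (simp add: flip_on_def algebra_simps)
      qed
      then have "sum (flip_on nbrs V1 y) (nbrs v) = z * sum y (nbrs v)" by (simp add: sum_distrib_left)
      moreover have "flip_on nbrs V1 y v = y v" using that(1) sides(2) by (auto simp: flip_on_def)
      ultimately show ?thesis using that(1) by (simp add: flip_on_def[of nbrs V0])
    qed
    have "(\<forall>i<n. flip_on nbrs V0 (flip_on nbrs V1 y) i = z * y i) \<longleftrightarrow>
        (\<forall>v\<in>V1. flip_on nbrs V0 (flip_on nbrs V1 y) v = z * y v) \<and> (\<forall>v\<in>V0. flip_on nbrs V0 (flip_on nbrs V1 y) v = z * y v)"
      using sides(1) by blast
    also have "(\<forall>v\<in>V1. flip_on nbrs V0 (flip_on nbrs V1 y) v = z * y v) \<longleftrightarrow> (\<forall>v\<in>V1. sum y (nbrs v) = (1 + z) * y v)"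
      by (intro ball_cong refl) (auto simp: 1 algebra_simps)
    also have "(\<forall>v\<in>V1. sum y (nbrs v) = (1 + z) * y v) \<and> (\<forall>v\<in>V0. flip_on nbrs V0 (flip_on nbrs V1 y) v = z * y v) \<longleftrightarrow>
        (\<forall>v\<in>V1. sum y (nbrs v) = (1 + z) * y v) \<and> (\<forall>v\<in>V0. z * sum y (nbrs v) = (1 + z) * y v)"
      by (intro conj_cong ball_cong refl) (auto simp: 0 algebra_simps)
    finally show ?thesis .
  qed
  let ?M = "map_mat of_int coxeter_int_matrix :: complex mat"
  have dim: "dim_row ?M = n" by (simp add: coxeter_int_matrix_def)
  have "?L \<longleftrightarrow> (\<exists>v \<in> carrier_vec n. v \<noteq> 0\<^sub>v n \<and> ?M *\<^sub>v v = z \<cdot>\<^sub>v v)"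
    unfolding map_mat_matrix_of_coxeter eigenvalue_def eigenvector_def dim by blast
  also have "\<dots> \<longleftrightarrow> (\<exists>y. vec n y \<noteq> 0\<^sub>v n \<and> ?M *\<^sub>v vec n y = z \<cdot>\<^sub>v vec n y)"
  proof
    assume "\<exists>v \<in> carrier_vec n. v \<noteq> 0\<^sub>v n \<and> ?M *\<^sub>v v = z \<cdot>\<^sub>v v"
    then obtain v where v: "v \<in> carrier_vec n" "v \<noteq> 0\<^sub>v n" "?M *\<^sub>v v = z \<cdot>\<^sub>v v" by blast
    moreover have "vec n (($) v) = v" using v(1) by (intro eq_vecI) auto
    ultimately show "\<exists>y. vec n y \<noteq> 0\<^sub>v n \<and> ?M *\<^sub>v vec n y = z \<cdot>\<^sub>v vec n y"
      by (intro exI[of _ "($) v"]) simp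
  qed (use vec_carrier in blast)
  also have "\<dots> \<longleftrightarrow> (\<exists>y. (\<exists>i<n. y i \<noteq> 0) \<and> (\<forall>i<n. flip_on nbrs V0 (flip_on nbrs V1 y) i = z * y i))"
    unfolding coxeter_int_matrix_mult by (auto simp: vec_eq_iff)
  finally show ?thesis unfolding step .
qed

text \<open>
  Pairing the equations on \<open>V1\<close> and on \<open>V0\<close> with the eigenvector, and using that the adjacency matrix
  is symmetric, gives \<open>(z + \<bar>z\<bar>\<^sup>2) a = (1 + z) b\<close> with the squared norms \<open>a\<close> and \<open>b\<close> of the two parts of
  the eigenvector. The imaginary part yields \<open>a = b\<close> and then \<open>\<bar>z\<bar> = 1\<close>, unless \<open>z\<close> is real; for real
  \<open>z \<noteq> -1\<close> it follows that \<open>z a = b\<close>, which makes \<open>z\<close> positive.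
\<close>

lemma coxeter_eigenvalue_location:
  assumes "eigenvalue (map_mat complex_of_real (matrix_of n (coxeter_transformation G V0 V1))) z"
  shows "cmod z = 1 \<or> (\<exists>r > 0. z = complex_of_real r)"
proof -
  obtain y i where y: "i < n" "y i \<noteq> 0" "\<And>v. v \<in> V1 \<Longrightarrow> sum y (nbrs v) = (1 + z) * y v"
      "\<And>v. v \<in> V0 \<Longrightarrow> z * sum y (nbrs v) = (1 + z) * y v"
    using assms unfolding coxeter_eigenvalue_iff by blast
  define a where "a = (\<Sum>v\<in>V1. (cmod (y v))\<^sup>2)"
  define b where "b = (\<Sum>v\<in>V0. (cmod (y v))\<^sup>2)"
  define s where "s = (\<Sum>v\<in>V1. sum y (nbrs v) * cnj (y v))"
  have nonneg: "a \<ge> 0" "b \<ge> 0" by (auto simp: a_def b_def intro: sum_nonneg)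
  have "a > 0 \<or> b > 0"
  proof -
    have "0 < (cmod (y i))\<^sup>2" using y(2) by simp
    moreover have "i \<in> V1 \<Longrightarrow> (cmod (y i))\<^sup>2 \<le> a" "i \<in> V0 \<Longrightarrow> (cmod (y i))\<^sup>2 \<le> b"
      unfolding a_def b_def using finite_sides by (auto intro: member_le_sum)
    moreover have "i \<in> V0 \<or> i \<in> V1" using y(1) sides(1) by auto
    ultimately show ?thesis by (metis order_less_le_trans)
  qed
  have s: "s = (1 + z) * of_real a"
  proof -
    have "s = (\<Sum>v\<in>V1. (1 + z) * (y v * cnj (y v)))"
      unfolding s_def by (intro sum.cong) (auto simp: y(3))
    then show ?thesis unfolding a_def of_real_sum complex_norm_square sum_distrib_left .
  qed
  have "cnj s = (\<Sum>v\<in>V1. \<Sum>w\<in>{w\<in>V0. (w, v) \<in> parcs G}. cnj (y w) * y v)"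
  proof -
    have "nbrs v = {w\<in>V0. (w, v) \<in> parcs G}" if "v \<in> V1" for v
      using nbrs_sides(2)[OF that] sides(1) by (auto simp: nbrs_def)
    then show ?thesis unfolding s_def by (simp add: sum_distrib_right)
  qed
  also have "\<dots> = (\<Sum>w\<in>V0. \<Sum>v\<in>{v\<in>V1. (w, v) \<in> parcs G}. cnj (y w) * y v)"
    by (rule sum.swap_restrict) (rule finite_sides)+
  also have "\<dots> = (\<Sum>w\<in>V0. sum y (nbrs w) * cnj (y w))"
  proof (intro sum.cong refl)
    fix w assume "w \<in> V0"
    then have "nbrs w = {v\<in>V1. (w, v) \<in> parcs G}"
      using nbrs_sides(1)[of w] sides(1) sym_arc by (auto simp: nbrs_def)
    then show "(\<Sum>v\<in>{v\<in>V1. (w, v) \<in> parcs G}. cnj (y w) * y v) = sum y (nbrs w) * cnj (y w)"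
      by (simp add: sum_distrib_left mult.commute)
  qed
  finally have "cnj s = (\<Sum>w\<in>V0. sum y (nbrs w) * cnj (y w))" .
  then have "z * cnj s = (\<Sum>w\<in>V0. (z * sum y (nbrs w)) * cnj (y w))"
    by (simp only: sum_distrib_left[of z _ V0] mult.assoc)
  also have "\<dots> = (\<Sum>w\<in>V0. (1 + z) * (y w * cnj (y w)))"
    by (intro sum.cong refl) (simp only: y(4) mult.assoc)
  also have "\<dots> = (1 + z) * of_real b"
    unfolding b_def of_real_sum complex_norm_square sum_distrib_left ..
  finally have key: "(z + z * cnj z) * of_real a = (1 + z) * of_real b"
    unfolding s by (simp add: algebra_simps)
  have zz: "z * cnj z = of_real ((cmod z)\<^sup>2)" by (rule complex_norm_square[symmetric])
  have im: "Im z * a = Im z * b" and re: "(Re z + (cmod z)\<^sup>2) * a = (1 + Re z) * b"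
    using arg_cong[OF key, of Im] arg_cong[OF key, of Re] unfolding zz by simp_all
  show ?thesis
  proof (cases "Im z = 0")
    case False
    with im have "a = b" by simp
    with \<open>a > 0 \<or> b > 0\<close> have "a > 0" by auto
    with re \<open>a = b\<close> have "(cmod z)\<^sup>2 = 1" by simp
    then show ?thesis by (simp add: power2_eq_1_iff) (use norm_ge_zero[of z] in linarith)
  next
    case True
    define r where "r = Re z"
    have z: "z = of_real r" using True by (simp add: r_def complex_eq_iff)
    have "(r + r\<^sup>2) * a = (1 + r) * b" using re unfolding z by simp
    then have "(1 + r) * (r * a - b) = 0" by (simp add: power2_eq_square algebra_simps)
    then consider "r = -1" | "r * a = b" by fastforce
    then show ?thesis
    proof cases
      case 1
      then show ?thesis by (simp add: z)
    next
      case 2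
      have "r \<noteq> 0"
      proof
        assume "r = 0"
        then have "y v = 0" if "v \<in> V0" for v using y(4)[OF that] by (simp add: z)
        moreover from this have "y v = 0" if "v \<in> V1" for v
          using y(3)[OF that] nbrs_sides(2)[OF that] \<open>r = 0\<close> by (simp add: z sum.neutral subset_iff)
        ultimately show False using y(1,2) sides(1) by blast
      qed
      moreover have "\<not> r < 0"
      proof
        assume "r < 0"
        have "\<not> a > 0"
        proof
          assume "a > 0"
          with \<open>r < 0\<close> have "r * a < 0" by (rule mult_neg_pos)
          with 2 nonneg show False by linarith
        qed
        with nonneg have "a = 0" by linarith
        with 2 \<open>a > 0 \<or> b > 0\<close> show False by simp
      qed
      ultimately show ?thesis using z by (intro disjI2 exI[of _ r]) auto
    qed
  qed
qed

end

section \<open>Bi-Perron numbers and trees\<close>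

lemma joukowski_real:
  assumes "cmod l = 1 \<or> l \<in> \<real>"
  shows "l + 1 / l \<in> \<real>"
  using assms
proof
  assume "cmod l = 1"
  then have "l * cnj l = 1" using complex_norm_square[of l] by simp
  then have "1 / l = cnj l" using inverse_unique[of l "cnj l"] by (simp add: inverse_eq_divide)
  then show ?thesis by (simp add: complex_add_cnj)
qed auto

text \<open>
  The roots of the minimal polynomial of \<open>(l + 1 / l)\<^sup>2\<close> have the form \<open>(w + 1 / w)\<^sup>2\<close> for conjugates \<open>w\<close>
  of \<open>l\<close>. They are squares of real numbers, and nonzero by irreducibility unless \<open>l + 1 / l = 0\<close>.
\<close>

lemma joukowski_branch_sum:
  fixes l :: complex
  assumes "irreducible p" "eval_rat p l = 0" "algebraic_unit l"
    and S1R: "\<And>w :: complex. eval_rat p w = 0 \<Longrightarrow> cmod w = 1 \<or> w \<in> \<real>"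
  shows "\<exists>r. l + 1 / l = of_real r \<and> r \<in> branch_sums r"
proof -
  have "l \<noteq> 0" using assms(3) by (simp add: algebraic_unit_def)
  obtain r where r: "l + 1 / l = of_real r" using joukowski_real[OF S1R[OF assms(2)]] by (rule Reals_cases)
  have sq: "(l + 1 / l)\<^sup>2 = of_real (r\<^sup>2)" by (simp add: r)
  have int: "algebraic_int (r\<^sup>2)"
    using algebraic_int_joukowski_square[OF assms(3)] unfolding sq algebraic_int_of_real_iff .
  have "r \<in> branch_sums r"
  proof (cases "r = 0")
    case True
    then show ?thesis using branch_sums.zero[of 0] by simp
  next
    case False
    obtain P where P: "eval_int P (r\<^sup>2) = 0" "lead_coeff P = 1"
      using int by (auto simp: algebraic_int_altdef_ipoly)
    then have "eval_rat (map_poly of_int P) (r\<^sup>2) = 0" by (simp add: eval_rat_of_int_poly)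
    moreover have "map_poly of_int P \<noteq> (0 :: rat poly)" using P(2) by auto
    ultimately obtain f where f: "irreducible f" "eval_rat f (r\<^sup>2) = 0"
      using exists_irreducible_with_root by blast
    then have fc: "eval_rat f ((l + 1 / l)\<^sup>2) = 0" unfolding sq by (simp only: eval_rat_of_real of_real_0)
    show ?thesis
    proof (rule totally_real_in_branch_sums[OF int f])
      fix z :: complex assume z: "eval_rat f z = 0"
      obtain w where w: "eval_rat p w = 0" "(w\<^sup>2 + 1)\<^sup>2 = z * w\<^sup>2"
        using conjugate_of_joukowski_square[OF f(1) _ \<open>l \<noteq> 0\<close> assms(2) fc z] assms(1) by auto
      have "w \<noteq> 0" using conjugate_nonzero[OF assms(1,2) w(1) \<open>l \<noteq> 0\<close>] .
      have "((w + 1 / w) * w)\<^sup>2 = z * w\<^sup>2"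
        using \<open>w \<noteq> 0\<close> w(2) by (simp add: distrib_right power2_eq_square)
      then have "z = (w + 1 / w)\<^sup>2" using \<open>w \<noteq> 0\<close> by (simp add: power_mult_distrib)
      moreover obtain x where "w + 1 / w = of_real x"
        using joukowski_real[OF S1R[OF w(1)]] by (rule Reals_cases)
      ultimately have "z = of_real (x\<^sup>2)" by simp
      moreover have "z \<noteq> 0"
        using conjugate_nonzero[OF f(1) fc z] False unfolding sq by simp
      ultimately show "\<exists>x > 0. z = of_real x" by (intro exI[of _ "x\<^sup>2"]) auto
    qed
  qed
  with r show ?thesis by blast
qed

text \<open>
  A tree realising \<open>r\<close> as a branch sum satisfies the eigenvalue equation for \<open>r\<close> at the root too. The
  eigenvector, multiplied by \<open>l\<close> on \<open>V0\<close>, solves the equations for the Coxeter transformation since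
  \<open>l r = 1 + l\<^sup>2\<close>.
\<close>

lemma coxeter_tree_eigenvalue_if_branch_sum:
  assumes "l \<noteq> 0" "l + 1 / l = of_real r" "r \<in> branch_sums r"
  shows "coxeter_tree_eigenvalue (l\<^sup>2)"
proof -
  obtain n p x and c :: "nat \<Rightarrow> bool" where
    realised: "n > 0" "\<forall>v. 0 < v \<and> v < n \<longrightarrow> p v < v \<and> c v \<noteq> c (p v)" "x 0 = 1"
      "adj_sum n p x 0 = r" "\<forall>v. 0 < v \<and> v < n \<longrightarrow> adj_sum n p x v = r * x v"
    using branch_sum_realised[OF assms(3)] by blast
  have tree: "n > 0" "\<And>v. 0 < v \<Longrightarrow> v < n \<Longrightarrow> p v < v" "\<And>v. 0 < v \<Longrightarrow> v < n \<Longrightarrow> c v \<noteq> c (p v)"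
    using realised(1,2) by simp_all
  have x: "adj_sum n p x v = r * x v" if "v < n" for v
    using realised(3-5) that by (cases "v = 0") simp_all
  let ?G = "parent_graph n p"
  let ?V0 = "{v. v < n \<and> c v}" and ?V1 = "{v. v < n \<and> \<not> c v}"
  have ft: "finite_tree ?G" using tree(1,2) by (rule finite_tree_parent_graph)
  have verts: "pverts ?G = {..<n}" by (simp add: parent_graph_def)
  have bip: "bipartition ?G ?V0 ?V1"
  proof -
    have arc: "v < n \<and> w < n \<and> c v \<noteq> c w" if "(v, w) \<in> parcs ?G" for v w
    proof -
      from that have "0 < v \<and> v < n \<and> w = p v \<or> 0 < w \<and> w < n \<and> v = p w"
        by (simp add: parent_graph_def)
      then show ?thesis
        using tree(2,3)[of v] tree(2,3)[of w] by (elim disjE) auto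
    qed
    show ?thesis
      unfolding bipartition_def verts
    proof (intro conjI)
      show "\<forall>(u, v)\<in>parcs ?G. u \<in> ?V0 \<and> v \<in> ?V1 \<or> u \<in> ?V1 \<and> v \<in> ?V0"
        using arc by blast
    qed auto
  qed
  interpret bipartite_graph_on n ?G ?V0 ?V1
    using ft verts bip by (intro bipartite_graph_on.intro) (simp_all add: finite_tree_def)
  define y where "y v = (if c v then l * of_real (x v) else of_real (x v))" for v
  have adj: "sum x (nbrs v) = r * x v" if "v < n" for v
    using sum_neighbours_parent_graph[OF tree(2) that, where x = x] x[OF that] unfolding nbrs_def by simp
  have lr: "l * of_real r = 1 + l\<^sup>2"
    using assms(1) unfolding assms(2)[symmetric] by (simp add: distrib_left power2_eq_square)
  have "sum y (nbrs v) = (1 + l\<^sup>2) * y v" if v: "v \<in> ?V1" for v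
  proof -
    have "sum y (nbrs v) = l * of_real (sum x (nbrs v))"
      unfolding of_real_sum sum_distrib_left using nbrs_sides(2)[OF v] by (intro sum.cong) (auto simp: y_def)
    also have "\<dots> = (l * of_real r) * y v" using v by (simp add: adj y_def)
    finally show ?thesis unfolding lr .
  qed
  moreover have "l\<^sup>2 * sum y (nbrs v) = (1 + l\<^sup>2) * y v" if v: "v \<in> ?V0" for v
  proof -
    have "sum y (nbrs v) = of_real (sum x (nbrs v))"
      unfolding of_real_sum using nbrs_sides(1)[OF v] by (intro sum.cong) (auto simp: y_def)
    also have "sum x (nbrs v) = r * x v" using v by (intro adj) simp
    finally have "l\<^sup>2 * sum y (nbrs v) = (l * of_real r) * y v"
      using v by (simp add: y_def power2_eq_square)
    then show ?thesis unfolding lr .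
  qed
  moreover have "y 0 \<noteq> 0" using assms(1) realised(3) by (simp add: y_def)
  ultimately have "eigenvalue (map_mat complex_of_real (matrix_of n (coxeter_transformation ?G ?V0 ?V1))) (l\<^sup>2)"
    unfolding coxeter_eigenvalue_iff using tree(1) by blast
  then show ?thesis unfolding coxeter_tree_eigenvalue_def using ft verts bip by blast
qed

text \<open>
  The characteristic polynomial of the Coxeter transformation is rational, and composed with \<open>x\<^sup>2\<close> it
  vanishes at \<open>l\<close>, hence at every conjugate of \<open>l\<close>.
\<close>

lemma conjugates_of_coxeter_tree_eigenvalue:
  assumes "coxeter_tree_eigenvalue (l\<^sup>2)" "w \<in> galois_conjugates l"
  shows "cmod w = 1 \<or> w \<in> \<real>"
proof -
  obtain n G V0 V1 where G: "finite_tree G" "pverts G = {..<n}" "bipartition G V0 V1"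
    "eigenvalue (map_mat complex_of_real (matrix_of n (coxeter_transformation G V0 V1))) (l\<^sup>2)"
    using assms(1) unfolding coxeter_tree_eigenvalue_def by blast
  interpret bipartite_graph_on n G V0 V1
    using G(1-3) by (intro bipartite_graph_on.intro) (simp_all add: finite_tree_def)
  obtain p where p: "irreducible p" "eval_rat p l = 0" "eval_rat p w = 0"
    using assms(2) by (auto simp: galois_conjugates_def)
  let ?q = "pcompose (map_poly of_int (char_poly coxeter_int_matrix)) [:0, 0, 1:] :: rat poly"
  have q: "eval_rat ?q z = eval_int (char_poly coxeter_int_matrix) (z\<^sup>2)" for z :: complex
    by (simp add: of_rat_hom.map_poly_pcompose poly_pcompose eval_rat_of_int_poly
        of_rat_hom.map_poly_pCons_hom power2_eq_square)
  have "eval_rat ?q l = 0" using G(4) unfolding q coxeter_eigenvalue_iff_root .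
  then have "p dvd ?q" by (rule irreducible_dvd_if_common_root[OF p(1,2)])
  then have "eval_rat ?q w = 0" using p(3) by (rule eval_rat_eq_0_if_dvd)
  then have "cmod (w\<^sup>2) = 1 \<or> (\<exists>r > 0. w\<^sup>2 = complex_of_real r)"
    unfolding q coxeter_eigenvalue_iff_root[symmetric] by (rule coxeter_eigenvalue_location)
  then show ?thesis
  proof
    assume "cmod (w\<^sup>2) = 1"
    then show ?thesis by (simp add: norm_power power2_eq_1_iff) (use norm_ge_zero[of w] in linarith)
  next
    assume "\<exists>r > 0. w\<^sup>2 = complex_of_real r"
    then obtain r where "r > 0" "w\<^sup>2 = complex_of_real r" by blast
    then have "w\<^sup>2 = (complex_of_real (sqrt r))\<^sup>2" by (simp flip: of_real_power)
    then show ?thesis by (auto simp: power2_eq_iff)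
  qed
qed

theorem theorem3:
  fixes \<mu> :: real and l :: complex
  assumes "bi_Perron \<mu>"
    and "l \<in> galois_conjugates (complex_of_real \<mu>)"
  shows "galois_conjugates l \<subseteq> {z. cmod z = 1} \<union> \<real> \<longleftrightarrow>
         coxeter_tree_eigenvalue (l\<^sup>2)"
proof
  assume S1R: "galois_conjugates l \<subseteq> {z. cmod z = 1} \<union> \<real>"
  obtain p where p: "irreducible p" "lead_coeff p = 1" "eval_rat p (complex_of_real \<mu>) = 0" "eval_rat p l = 0"
    using assms(2) by (auto simp: galois_conjugates_def)
  have "algebraic_unit \<mu>" using assms(1) by (simp add: bi_Perron_def)
  then have "algebraic_unit (complex_of_real \<mu>)"
    by (simp add: algebraic_unit_def flip: of_real_inverse)
  then have unit: "algebraic_unit l" by (rule algebraic_unit_conjugate[OF p(1,3,4)])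
  have "cmod w = 1 \<or> w \<in> \<real>" if "eval_rat p w = 0" for w :: complex
    using S1R p that by (auto simp: galois_conjugates_def)
  then obtain r where "l + 1 / l = of_real r" "r \<in> branch_sums r"
    using joukowski_branch_sum[OF p(1,4) unit] by blast
  then show "coxeter_tree_eigenvalue (l\<^sup>2)"
    using unit by (intro coxeter_tree_eigenvalue_if_branch_sum) (auto simp: algebraic_unit_def)
next
  assume "coxeter_tree_eigenvalue (l\<^sup>2)"
  then show "galois_conjugates l \<subseteq> {z. cmod z = 1} \<union> \<real>"
    using conjugates_of_coxeter_tree_eigenvalue by blast
qed

end
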